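(* Let $X$ be a compact Hausdorff space and $G$ a finite group acting on $X$. Let $\alpha$ be the induced action of $G$ on $C(X)$ and let $E:C(X)\to C(X)^\alpha$, $E(f)=\frac1{|G|}\sum_{g\in G}\alpha_g(f)$, be the canonical conditional expectation. Then the following are equivalent: (i) $G$ acts freely on $X$. (ii) $E:C(X)\to C(X)^\alpha$ is of index-finite type with $Index(E)=|G|$. (iii) $\alpha$ is saturated.
   Context: $G$ acts on $X$ by homeomorphisms, and the induced action is $\alpha_g(f)(x)=f(g^{-1}x)$ for $f\in C(X)$, with fixed point algebra $C(X)^\alpha$. The action of $G$ on $X$ is free if $gx\ne x$ for all $x\in X$ and all $g\in G$ different from the identity. $|G|$ in (ii) denotes the constant function $|G|\cdot 1$. **Saturated.** For an action $\alpha$ of a finite group $G$ on a unital $C^*$-algebra $M$ (here $M=C(X)$), $M\times_\alpha G=\mathrm{span}\{x\lambda_g\mid x\in M,g\in G\}$ is the usual crossed product, with implementing unitaries $\lambda_g$, $\lambda_gx\lambda_g^*=\alpha_g(x)$. The action $\alpha$ is saturated if the closed two-sided ideal of $M\times_\alpha G$ generated by the projection $e=\frac1{|G|}\sum_{g\in G}\lambda_g$ is all of $M\times_\alpha G$. **Index-finite type.** A faithful conditional expectation $E:B\to C$ from a unital $C^*$-algebra $B$ onto a $C^*$-subalgebra $C$ containing the unit of $B$ is of index-finite type if there are finitely many $v_1,\dots,v_n\in B$ with $b=\sum_iE(bv_i)v_i^*=\sum_iv_iE(v_i^*b)$ for all $b\in B$; then $\{(v_i,v_i^* )\}$ is called a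 quasi-basis for $E$, and $Index(E)=\sum_iv_iv_i^*$, which is a central element of $B$ independent of the choice of quasi-basis. *)

theory Defs
  imports "HOL-Analysis.Analysis" "HOL-Algebra.Group_Action" "HOL-Algebra.Ideal" "HOL-Algebra.Module"
begin

text \<open>The definitions for a general structure \<open>A\<close>, \<open>B\<close> or \<open>M\<close> of the following type are intended for
  unital C*-algebras. The C*-axioms are not part of the type.\<close>

record 'b star_algebra = "(complex, 'b) module" +
  star :: "'b \<Rightarrow> 'b" (\<open>\<sharp>\<index> _\<close> [81] 80)
  nrm :: "'b \<Rightarrow> real" (\<open>\<parallel>_\<parallel>\<index>\<close>)

definition norm_closed :: "('b, 'm) star_algebra_scheme \<Rightarrow> 'b set \<Rightarrow> bool" where
  "norm_closed A S \<longleftrightarrow>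
     (\<forall>x\<in>carrier A. (\<forall>\<epsilon>>0. \<exists>s\<in>S. \<parallel>x \<ominus>\<^bsub>A\<^esub> s\<parallel>\<^bsub>A\<^esub> < \<epsilon>) \<longrightarrow> x \<in> S)"

definition closed_genideal :: "('b, 'm) star_algebra_scheme \<Rightarrow> 'b set \<Rightarrow> 'b set" where
  "closed_genideal A S = \<Inter>{I. ideal I A \<and> norm_closed A I \<and> S \<subseteq> I}"

definition positive_elements :: "('b, 'm) star_algebra_scheme \<Rightarrow> 'b set" where
  "positive_elements A = {(\<sharp>\<^bsub>A\<^esub> b) \<otimes>\<^bsub>A\<^esub> b | b. b \<in> carrier A}"

definition unital_cstar_subalgebra :: "('b, 'm) star_algebra_scheme \<Rightarrow> 'b set \<Rightarrow> bool" where
  "unital_cstar_subalgebra B C \<longleftrightarrow>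
     C \<subseteq> carrier B \<and> \<one>\<^bsub>B\<^esub> \<in> C \<and>
     (\<forall>a\<in>C. \<forall>b\<in>C. a \<oplus>\<^bsub>B\<^esub> b \<in> C \<and> a \<otimes>\<^bsub>B\<^esub> b \<in> C) \<and>
     (\<forall>z. \<forall>a\<in>C. z \<odot>\<^bsub>B\<^esub> a \<in> C) \<and>
     (\<forall>a\<in>C. \<sharp>\<^bsub>B\<^esub> a \<in> C) \<and>
     norm_closed B C"

definition faithful_conditional_expectation ::
    "('b, 'm) star_algebra_scheme \<Rightarrow> 'b set \<Rightarrow> ('b \<Rightarrow> 'b) \<Rightarrow> bool" where
  "faithful_conditional_expectation B C E \<longleftrightarrow>
     unital_cstar_subalgebra B C \<and>
     E \<in> carrier B \<rightarrow> C \<and>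
     (\<forall>a\<in>carrier B. \<forall>b\<in>carrier B. E (a \<oplus>\<^bsub>B\<^esub> b) = E a \<oplus>\<^bsub>B\<^esub> E b) \<and>
     (\<forall>z. \<forall>b\<in>carrier B. E (z \<odot>\<^bsub>B\<^esub> b) = z \<odot>\<^bsub>B\<^esub> E b) \<and>
     (\<forall>c\<in>C. E c = c) \<and>
     (\<forall>c\<in>C. \<forall>b\<in>carrier B. E (c \<otimes>\<^bsub>B\<^esub> b) = c \<otimes>\<^bsub>B\<^esub> E b \<and> E (b \<otimes>\<^bsub>B\<^esub> c) = E b \<otimes>\<^bsub>B\<^esub> c) \<and>
     (\<forall>p\<in>positive_elements B. E p \<in> positive_elements B) \<and>
     (\<forall>b\<in>carrier B. E ((\<sharp>\<^bsub>B\<^esub> b) \<otimes>\<^bsub>B\<^esub> b) = \<zero>\<^bsub>B\<^esub> \<longrightarrow> b = \<zero>\<^bsub>B\<^esub>)"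

text \<open>The finite family \<open>v 0, \<dots>, v (n - 1)\<close> stands for the quasi-basis of the pairs
  \<open>(v i, (v i)*)\<close>.\<close>

definition quasi_basis ::
    "('b, 'm) star_algebra_scheme \<Rightarrow> ('b \<Rightarrow> 'b) \<Rightarrow> nat \<Rightarrow> (nat \<Rightarrow> 'b) \<Rightarrow> bool" where
  "quasi_basis B E n v \<longleftrightarrow>
     v \<in> {..<n} \<rightarrow> carrier B \<and>
     (\<forall>b\<in>carrier B.
        b = (\<Oplus>\<^bsub>B\<^esub>i\<in>{..<n}. E (b \<otimes>\<^bsub>B\<^esub> v i) \<otimes>\<^bsub>B\<^esub> (\<sharp>\<^bsub>B\<^esub> (v i))) \<and>
        b = (\<Oplus>\<^bsub>B\<^esub>i\<in>{..<n}. v i \<otimes>\<^bsub>B\<^esub> E ((\<sharp>\<^bsub>B\<^esub> (v i)) \<otimes>\<^bsub>B\<^esub> b)))"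

definition index_finite_type ::
    "('b, 'm) star_algebra_scheme \<Rightarrow> 'b set \<Rightarrow> ('b \<Rightarrow> 'b) \<Rightarrow> bool" where
  "index_finite_type B C E \<longleftrightarrow>
     faithful_conditional_expectation B C E \<and> (\<exists>n v. quasi_basis B E n v)"

text \<open>Meaningful only for \<open>E\<close> of index-finite type: then the value below does not depend
  on the quasi-basis.\<close>

definition expectation_index :: "('b, 'm) star_algebra_scheme \<Rightarrow> ('b \<Rightarrow> 'b) \<Rightarrow> 'b" where
  "expectation_index B E =
     (THE z. \<exists>n v. quasi_basis B E n v \<and> z = (\<Oplus>\<^bsub>B\<^esub>i\<in>{..<n}. v i \<otimes>\<^bsub>B\<^esub> (\<sharp>\<^bsub>B\<^esub> (v i))))"

definition fixed_point_algebra ::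
    "('b, 'm) star_algebra_scheme \<Rightarrow> ('g, 'n) monoid_scheme \<Rightarrow> ('g \<Rightarrow> 'b \<Rightarrow> 'b) \<Rightarrow> 'b set" where
  "fixed_point_algebra M G \<alpha> = {x \<in> carrier M. \<forall>g\<in>carrier G. \<alpha> g x = x}"

definition canonical_expectation ::
    "('b, 'm) star_algebra_scheme \<Rightarrow> ('g, 'n) monoid_scheme \<Rightarrow> ('g \<Rightarrow> 'b \<Rightarrow> 'b) \<Rightarrow> 'b \<Rightarrow> 'b" where
  "canonical_expectation M G \<alpha> x =
     (1 / of_nat (order G)) \<odot>\<^bsub>M\<^esub> (\<Oplus>\<^bsub>M\<^esub>g\<in>carrier G. \<alpha> g x)"

text \<open>The norm on the space of functions from \<open>G\<close> to \<open>M\<close> given by the \<open>M\<close>-valued inner product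
  \<open>\<langle>\<xi>, \<eta>\<rangle> = \<Sum>\<^sub>h \<xi>(h)* \<eta>(h)\<close>; this is the Hilbert module \<open>\<ell>\<^sup>2(G, M)\<close>.\<close>

definition l2_norm ::
    "('b, 'm) star_algebra_scheme \<Rightarrow> ('g, 'n) monoid_scheme \<Rightarrow> ('g \<Rightarrow> 'b) \<Rightarrow> real" where
  "l2_norm M G \<xi> = sqrt (\<parallel>\<Oplus>\<^bsub>M\<^esub>h\<in>carrier G. (\<sharp>\<^bsub>M\<^esub> (\<xi> h)) \<otimes>\<^bsub>M\<^esub> \<xi> h\<parallel>\<^bsub>M\<^esub>)"

text \<open>The regular representation of \<open>a = \<Sum>\<^sub>g a(g) \<lambda>\<^sub>g\<close> on \<open>\<ell>\<^sup>2(G, M)\<close>: an element \<open>x\<close> of \<open>M\<close> acts by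
  \<open>(x \<xi>)(h) = \<alpha>\<^bsub>inv h\<^esub>(x) \<xi>(h)\<close> and \<open>\<lambda>\<^sub>g\<close> by \<open>(\<lambda>\<^sub>g \<xi>)(h) = \<xi>(g\<^sup>-\<^sup>1 h)\<close>.\<close>

definition regular_rep ::
    "('b, 'm) star_algebra_scheme \<Rightarrow> ('g, 'n) monoid_scheme \<Rightarrow> ('g \<Rightarrow> 'b \<Rightarrow> 'b) \<Rightarrow>
     ('g \<Rightarrow> 'b) \<Rightarrow> ('g \<Rightarrow> 'b) \<Rightarrow> 'g \<Rightarrow> 'b" where
  "regular_rep M G \<alpha> a \<xi> =
     (\<lambda>h\<in>carrier G. \<Oplus>\<^bsub>M\<^esub>g\<in>carrier G. \<alpha> (inv\<^bsub>G\<^esub> h) (a g) \<otimes>\<^bsub>M\<^esub> \<xi> (inv\<^bsub>G\<^esub> g \<otimes>\<^bsub>G\<^esub> h))"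

text \<open>For finite \<open>G\<close>, the element \<open>\<Sum>\<^sub>g a(g) \<lambda>\<^sub>g\<close> of the crossed product is represented by its
  coefficient function \<open>a\<close>. The product and the involution are those forced by
  \<open>\<lambda>\<^sub>g x \<lambda>\<^sub>g* = \<alpha>\<^sub>g(x)\<close> and unitarity of \<open>\<lambda>\<^sub>g\<close>; the C*-norm is the operator norm in the
  (faithful) regular representation.\<close>

definition crossed_product ::
    "('b, 'm) star_algebra_scheme \<Rightarrow> ('g, 'n) monoid_scheme \<Rightarrow> ('g \<Rightarrow> 'b \<Rightarrow> 'b) \<Rightarrow>
     ('g \<Rightarrow> 'b) star_algebra" where
  "crossed_product M G \<alpha> =
     \<lparr> carrier = carrier G \<rightarrow>\<^sub>E carrier M,
       mult = (\<lambda>a b. \<lambda>k\<in>carrier G.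
                 \<Oplus>\<^bsub>M\<^esub>h\<in>carrier G. a h \<otimes>\<^bsub>M\<^esub> \<alpha> h (b (inv\<^bsub>G\<^esub> h \<otimes>\<^bsub>G\<^esub> k))),
       one = (\<lambda>k\<in>carrier G. if k = \<one>\<^bsub>G\<^esub> then \<one>\<^bsub>M\<^esub> else \<zero>\<^bsub>M\<^esub>),
       ring.zero = (\<lambda>k\<in>carrier G. \<zero>\<^bsub>M\<^esub>),
       add = (\<lambda>a b. \<lambda>k\<in>carrier G. a k \<oplus>\<^bsub>M\<^esub> b k),
       smult = (\<lambda>z a. \<lambda>k\<in>carrier G. z \<odot>\<^bsub>M\<^esub> a k),
       star = (\<lambda>a. \<lambda>k\<in>carrier G. \<alpha> k (\<sharp>\<^bsub>M\<^esub> (a (inv\<^bsub>G\<^esub> k)))),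
       nrm = (\<lambda>a. Sup {l2_norm M G (regular_rep M G \<alpha> a \<xi>) | \<xi>.
                         \<xi> \<in> carrier G \<rightarrow>\<^sub>E carrier M \<and> l2_norm M G \<xi> \<le> 1}) \<rparr>"

definition implementing_unitary ::
    "('b, 'm) star_algebra_scheme \<Rightarrow> ('g, 'n) monoid_scheme \<Rightarrow> 'g \<Rightarrow> 'g \<Rightarrow> 'b" where
  "implementing_unitary M G g = (\<lambda>k\<in>carrier G. if k = g then \<one>\<^bsub>M\<^esub> else \<zero>\<^bsub>M\<^esub>)"

definition averaging_projection ::
    "('b, 'm) star_algebra_scheme \<Rightarrow> ('g, 'n) monoid_scheme \<Rightarrow> ('g \<Rightarrow> 'b \<Rightarrow> 'b) \<Rightarrow> 'g \<Rightarrow> 'b" where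
  "averaging_projection M G \<alpha> =
     (1 / of_nat (order G)) \<odot>\<^bsub>crossed_product M G \<alpha>\<^esub>
       (\<Oplus>\<^bsub>crossed_product M G \<alpha>\<^esub>g\<in>carrier G. implementing_unitary M G g)"

definition saturated ::
    "('b, 'm) star_algebra_scheme \<Rightarrow> ('g, 'n) monoid_scheme \<Rightarrow> ('g \<Rightarrow> 'b \<Rightarrow> 'b) \<Rightarrow> bool" where
  "saturated M G \<alpha> \<longleftrightarrow>
     closed_genideal (crossed_product M G \<alpha>) {averaging_projection M G \<alpha>}
       = carrier (crossed_product M G \<alpha>)"

text \<open>Functions on \<open>topspace X\<close> are represented by their extension by zero to the whole type, so
  that the operations are pointwise and the supremum in the norm may range over the type.\<close>

definition cont_algebra :: "'a topology \<Rightarrow> ('a \<Rightarrow> complex) star_algebra" where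
  "cont_algebra X =
     \<lparr> carrier = {f. continuous_map X euclidean f \<and> (\<forall>x. x \<notin> topspace X \<longrightarrow> f x = 0)},
       mult = (\<lambda>f g x. f x * g x),
       one = (\<lambda>x. if x \<in> topspace X then 1 else 0),
       ring.zero = (\<lambda>x. 0),
       add = (\<lambda>f g x. f x + g x),
       smult = (\<lambda>z f x. z * f x),
       star = (\<lambda>f x. cnj (f x)),
       nrm = (\<lambda>f. SUP x. cmod (f x)) \<rparr>"

definition induced_action ::
    "'a topology \<Rightarrow> ('g, 'n) monoid_scheme \<Rightarrow> ('g \<Rightarrow> 'a \<Rightarrow> 'a) \<Rightarrow>
     'g \<Rightarrow> ('a \<Rightarrow> complex) \<Rightarrow> 'a \<Rightarrow> complex" where
  "induced_action X G \<phi> g f = (\<lambda>x. if x \<in> topspace X then f (\<phi> (inv\<^bsub>G\<^esub> g) x) else 0)"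

definition free_action ::
    "'a topology \<Rightarrow> ('g, 'n) monoid_scheme \<Rightarrow> ('g \<Rightarrow> 'a \<Rightarrow> 'a) \<Rightarrow> bool" where
  "free_action X G \<phi> \<longleftrightarrow>
     (\<forall>x\<in>topspace X. \<forall>g\<in>carrier G. g \<noteq> \<one>\<^bsub>G\<^esub> \<longrightarrow> \<phi> g x \<noteq> x)"

end

theory Submission
  imports Defs
begin

text \<open>Everything rests on the kernels \<open>\<Sum>\<^sub>i v\<^sub>i(x) cnj (v\<^sub>i(g x))\<close> of finite families in \<open>C(X)\<close>. If the
  action is free, each point has a bump function whose support is disjoint from its translates
  by \<open>g \<noteq> \<one>\<close>; finitely many of them, normalized, give a family whose kernel is \<open>|G|\<close> at
  \<open>g = \<one>\<close> and \<open>0\<close> elsewhere. Such a family is a quasi-basis with index \<open>|G|\<close>, and \<open>\<Sum>\<^sub>i v\<^sub>i e v\<^sub>i* = 1\<close>, so \<open>\<alpha>\<close> is saturated.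

  Conversely, evaluate the quasi-basis identity at \<open>x\<close> on a function that is \<open>1\<close> at \<open>x\<close> and \<open>0\<close> on the
  rest of its orbit: the kernel at a stabilizing \<open>g\<close> is the value of the index at \<open>x\<close>, so index \<open>|G|\<close>
  makes the stabilizer trivial. And the elements \<open>\<Sum>\<^sub>g a(g) \<lambda>\<^sub>g\<close> with \<open>a(t g)(y) = a(g)(y)\<close> whenever
  \<open>t y = y\<close> form a closed ideal that contains \<open>e\<close>, but contains \<open>1\<close> only if the action is free.\<close>

text \<open>Serves to place a sum of terms \<open>v e v*\<close> in every ideal that contains the
  projection \<open>e\<close>.\<close>

lemma (in ideal) finsum_in_ideal:
  assumes "finite A" "\<And>i. i \<in> A \<Longrightarrow> a i \<in> I"
  shows "(\<Oplus>i\<in>A. a i) \<in> I"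
  using assms
proof (induction A rule: finite_induct)
  case (insert i A)
  then have "finsum R a (insert i A) = a i \<oplus> finsum R a A"
    by (intro finsum_insert) (auto intro: Icarr)
  with insert show ?case
    by (simp add: a_closed)
qed simp

section \<open>The algebra of continuous functions\<close>

lemma cont_algebra_simps [simp]:
  "f \<otimes>\<^bsub>cont_algebra X\<^esub> g = (\<lambda>x. f x * g x)"
  "f \<oplus>\<^bsub>cont_algebra X\<^esub> g = (\<lambda>x. f x + g x)"
  "\<one>\<^bsub>cont_algebra X\<^esub> = (\<lambda>x. if x \<in> topspace X then 1 else 0)"
  "\<zero>\<^bsub>cont_algebra X\<^esub> = (\<lambda>x. 0)"
  "z \<odot>\<^bsub>cont_algebra X\<^esub> f = (\<lambda>x. z * f x)"
  "\<sharp>\<^bsub>cont_algebra X\<^esub> f = (\<lambda>x. cnj (f x))"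
  by (simp_all add: cont_algebra_def)

lemma cont_algebra_norm: "\<parallel>f\<parallel>\<^bsub>cont_algebra X\<^esub> = (SUP x. cmod (f x))"
  by (simp add: cont_algebra_def)

lemma cont_algebra_carrier:
  "f \<in> carrier (cont_algebra X) \<longleftrightarrow>
    continuous_map X euclidean f \<and> (\<forall>x. x \<notin> topspace X \<longrightarrow> f x = 0)"
  by (simp add: cont_algebra_def)

lemma cont_algebra_continuous:
  "f \<in> carrier (cont_algebra X) \<Longrightarrow> continuous_map X euclidean f"
  by (simp add: cont_algebra_carrier)

lemma cont_algebra_outside:
  "f \<in> carrier (cont_algebra X) \<Longrightarrow> x \<notin> topspace X \<Longrightarrow> f x = 0"
  by (simp add: cont_algebra_carrier)

lemma continuous_map_complex_mult:
  fixes f g :: "'a \<Rightarrow> complex"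
  shows "continuous_map X euclidean f \<Longrightarrow> continuous_map X euclidean g \<Longrightarrow>
    continuous_map X euclidean (\<lambda>x. f x * g x)"
  by (simp add: continuous_map_atin tendsto_mult)

text \<open>Cutting off to zero outside X does not affect continuity, which is tested on
  \<open>topspace X\<close> only. Functions known just on X enter the algebra this way.\<close>

lemma continuous_map_into_cont_algebra:
  assumes "continuous_map X euclidean f"
  shows "(\<lambda>x. if x \<in> topspace X then f x else 0) \<in> carrier (cont_algebra X)"
  using continuous_map_eq [OF assms] by (simp add: cont_algebra_carrier)

lemma
  assumes "f \<in> carrier (cont_algebra X)"
  shows cont_algebra_uminus_closed: "(\<lambda>x. - f x) \<in> carrier (cont_algebra X)"
    and cont_algebra_cnj_closed: "(\<lambda>x. cnj (f x)) \<in> carrier (cont_algebra X)"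
    and cont_algebra_scale_closed: "(\<lambda>x. z * f x) \<in> carrier (cont_algebra X)"
  using assms by (auto simp: cont_algebra_carrier continuous_map_atin
      intro: tendsto_minus tendsto_cnj tendsto_mult_left)

lemma cont_algebra_add_closed:
  assumes "f \<in> carrier (cont_algebra X)" "g \<in> carrier (cont_algebra X)"
  shows "(\<lambda>x. f x + g x) \<in> carrier (cont_algebra X)"
  using assms by (auto simp: cont_algebra_carrier intro: continuous_map_add)

lemma cont_algebra_mult_closed:
  assumes "f \<in> carrier (cont_algebra X)" "g \<in> carrier (cont_algebra X)"
  shows "(\<lambda>x. f x * g x) \<in> carrier (cont_algebra X)"
  using assms by (auto simp: cont_algebra_carrier intro: continuous_map_complex_mult)

lemma cont_algebra_zero_closed: "(\<lambda>x. 0) \<in> carrier (cont_algebra X)"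
  by (simp add: cont_algebra_carrier)

lemma cont_algebra_sum_closed:
  assumes "finite A" "\<And>i. i \<in> A \<Longrightarrow> f i \<in> carrier (cont_algebra X)"
  shows "(\<lambda>x. \<Sum>i\<in>A. f i x) \<in> carrier (cont_algebra X)"
  using assms by (auto simp: cont_algebra_carrier intro: continuous_map_sum)

lemma cont_algebra_one_closed:
  "(\<lambda>x. if x \<in> topspace X then 1 else 0) \<in> carrier (cont_algebra X)"
  by (rule continuous_map_into_cont_algebra) simp

lemma cont_algebra_abelian_group: "abelian_group (cont_algebra X)"
proof (rule abelian_groupI)
  show "\<exists>g\<in>carrier (cont_algebra X). g \<oplus>\<^bsub>cont_algebra X\<^esub> f = \<zero>\<^bsub>cont_algebra X\<^esub>"
    if "f \<in> carrier (cont_algebra X)" for f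
    by (rule bexI [OF _ cont_algebra_uminus_closed [OF that]]) simp
qed (auto simp: cont_algebra_add_closed cont_algebra_zero_closed algebra_simps)

lemma cont_algebra_minus:
  assumes "f \<in> carrier (cont_algebra X)" "g \<in> carrier (cont_algebra X)"
  shows "f \<ominus>\<^bsub>cont_algebra X\<^esub> g = (\<lambda>x. f x - g x)"
proof -
  interpret abelian_group "cont_algebra X"
    by (rule cont_algebra_abelian_group)
  have "\<ominus>\<^bsub>cont_algebra X\<^esub> g = (\<lambda>x. - g x)"
    using assms by (intro minus_equality) (auto intro: cont_algebra_uminus_closed)
  then show ?thesis
    by (simp add: a_minus_def)
qed

lemma cont_algebra_finsum:
  assumes "finite A" "\<And>i. i \<in> A \<Longrightarrow> f i \<in> carrier (cont_algebra X)"
  shows "(\<Oplus>\<^bsub>cont_algebra X\<^esub>i\<in>A. f i) = (\<lambda>x. \<Sum>i\<in>A. f i x)"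
proof -
  interpret abelian_group "cont_algebra X"
    by (rule cont_algebra_abelian_group)
  show ?thesis
    using assms
  proof (induction A rule: finite_induct)
    case (insert i A)
    then have "finsum (cont_algebra X) f (insert i A) =
        f i \<oplus>\<^bsub>cont_algebra X\<^esub> finsum (cont_algebra X) f A"
      by (intro finsum_insert) auto
    with insert show ?case by auto
  qed simp
qed

text \<open>The image of a compact space is bounded, so the supremum in the norm is a genuine one.
  The bound \<open>max B 0\<close> also covers the points off X, where f is 0, and thereby an empty
  X.\<close>

lemma cont_algebra_norm_upper:
  assumes "compact_space X" "f \<in> carrier (cont_algebra X)"
  shows "cmod (f x) \<le> \<parallel>f\<parallel>\<^bsub>cont_algebra X\<^esub>"
proof -
  have "compactin euclidean (f ` topspace X)"
    using assms image_compactin cont_algebra_continuous compact_space_def by metis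
  then have "bounded (f ` topspace X)"
    by (simp add: compact_imp_bounded)
  then obtain B where "\<And>x. x \<in> topspace X \<Longrightarrow> cmod (f x) \<le> B"
    by (auto simp: bounded_iff)
  then have "cmod (f x) \<le> max B 0" for x
    using cont_algebra_outside [OF assms(2), of x] by (cases "x \<in> topspace X") fastforce+
  then have "bdd_above (range (\<lambda>x. cmod (f x)))"
    by (intro bdd_aboveI2)
  then show ?thesis
    by (auto simp: cont_algebra_norm intro: cSUP_upper)
qed

lemma cont_algebra_norm_least:
  assumes "\<And>x. cmod (f x) \<le> c"
  shows "\<parallel>f\<parallel>\<^bsub>cont_algebra X\<^esub> \<le> c"
  using assms by (auto simp: cont_algebra_norm intro: cSUP_least)

text \<open>Finite sets are closed in a Hausdorff space and compact Hausdorff spaces are normal, so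
  Urysohn's lemma applies. The lemma isolates a point from the other points of its orbit.\<close>

lemma compact_Hausdorff_separates_from_finite:
  assumes "compact_space X" "Hausdorff_space X" "x \<in> topspace X" "finite F" "F \<subseteq> topspace X" "x \<notin> F"
  obtains f :: "'a \<Rightarrow> real" where "continuous_map X euclideanreal f"
    "f x = 1" "\<And>y. y \<in> F \<Longrightarrow> f y = 0"
proof -
  have "closedin X {x}" "closedin X F"
    using assms by (auto intro!: closedin_Hausdorff_finite)
  moreover have "normal_space X"
    using assms compact_Hausdorff_or_regular_imp_normal_space by blast
  moreover have "disjnt F {x}" using assms by auto
  ultimately obtain f where f: "continuous_map X (top_of_set {0..1::real}) f" "f ` F \<subseteq> {0}" "f ` {x} \<subseteq> {1}"
    by (metis Urysohn_lemma zero_le_one)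
  show ?thesis
    using f by (intro that [of f]) (auto simp: continuous_map_in_subtopology)
qed

text \<open>A pointwise nonnegative p is \<open>cnj b * b\<close> for its pointwise square root b,
  which is again continuous. In this form positivity of E is that of an average.\<close>

lemma cont_algebra_positive_iff:
  "p \<in> positive_elements (cont_algebra X) \<longleftrightarrow> p \<in> carrier (cont_algebra X) \<and> (\<forall>x. p x \<in> \<real>\<^sub>\<ge>\<^sub>0)"
proof
  assume "p \<in> positive_elements (cont_algebra X)"
  then obtain b where "b \<in> carrier (cont_algebra X)" "p = (\<lambda>x. cnj (b x) * b x)"
    by (auto simp: positive_elements_def)
  then show "p \<in> carrier (cont_algebra X) \<and> (\<forall>x. p x \<in> \<real>\<^sub>\<ge>\<^sub>0)"
    by (auto intro: cont_algebra_mult_closed cont_algebra_cnj_closed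
        simp: complex_nonneg_Reals_iff)
next
  assume p: "p \<in> carrier (cont_algebra X) \<and> (\<forall>x. p x \<in> \<real>\<^sub>\<ge>\<^sub>0)"
  define b where "b = (\<lambda>x. complex_of_real (sqrt (Re (p x))))"
  have "b \<in> carrier (cont_algebra X)"
    using p by (auto simp: b_def cont_algebra_carrier continuous_map_atin
        intro!: tendsto_intros)
  moreover have "cnj (b x) * b x = p x" for x
  proof -
    obtain r where "r \<ge> 0" "p x = of_real r"
      using p by (metis nonneg_Reals_cases)
    then show ?thesis
      by (simp add: b_def flip: of_real_mult)
  qed
  ultimately show "p \<in> positive_elements (cont_algebra X)"
    by (auto simp: positive_elements_def intro!: exI [of _ b])
qed

section \<open>Finite group actions\<close>

text \<open>Continuity is asked of every \<open>\<phi> g\<close>; since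
  \<open>\<phi> (inv g)\<close> is among these maps, each of them is a homeomorphism.\<close>

locale compact_group_action = group_action G "topspace X" \<phi>
  for X :: "'a topology" and G :: "('g, 'n) monoid_scheme" (structure) and \<phi> +
  assumes compact: "compact_space X" and Hausdorff: "Hausdorff_space X"
    and finite_group: "finite (carrier G)"
    and continuous: "g \<in> carrier G \<Longrightarrow> continuous_map X X (\<phi> g)"
begin

sublocale group G
  using group_hom group_hom.axioms(1) by blast

abbreviation "C \<equiv> cont_algebra X"
abbreviation "\<alpha> \<equiv> induced_action X G \<phi>"
abbreviation "E \<equiv> canonical_expectation C G \<alpha>"
abbreviation "CP \<equiv> crossed_product C G \<alpha>"

lemma action_closed: "g \<in> carrier G \<Longrightarrow> x \<in> topspace X \<Longrightarrow> \<phi> g x \<in> topspace X"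
  using element_image by blast

lemma action_one: "x \<in> topspace X \<Longrightarrow> \<phi> \<one> x = x"
  using id_eq_one by (metis restrict_apply')

lemma order_nonzero: "(of_nat (order G) :: complex) \<noteq> 0"
  using finite_group order_gt_0_iff_finite by simp

lemma sum_group_inv: "(\<Sum>g\<in>carrier G. f (inv g)) = (\<Sum>g\<in>carrier G. f g)"
  by (rule sum.reindex_bij_witness [where i = "m_inv G" and j = "m_inv G"]) auto

lemma sum_group_left: "h \<in> carrier G \<Longrightarrow> (\<Sum>g\<in>carrier G. f (h \<otimes> g)) = (\<Sum>g\<in>carrier G. f g)"
  by (rule sum.reindex_bij_witness [where i = "\<lambda>g. inv h \<otimes> g" and j = "\<lambda>g. h \<otimes> g"])
    (auto simp flip: m_assoc)

lemma sum_group_right: "h \<in> carrier G \<Longrightarrow> (\<Sum>g\<in>carrier G. f (g \<otimes> h)) = (\<Sum>g\<in>carrier G. f g)"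
  by (rule sum.reindex_bij_witness [where i = "\<lambda>g. g \<otimes> inv h" and j = "\<lambda>g. g \<otimes> h"])
    (auto simp: m_assoc)

section \<open>The induced action, its fixed points and the canonical expectation\<close>

lemma induced_action_closed:
  assumes "g \<in> carrier G" "f \<in> carrier C"
  shows "\<alpha> g f \<in> carrier C"
proof -
  have "continuous_map X euclidean (f \<circ> \<phi> (inv g))"
    using assms continuous cont_algebra_continuous by (intro continuous_map_compose) auto
  then show ?thesis
    using continuous_map_into_cont_algebra by (force simp: induced_action_def o_def)
qed

lemma induced_action_apply: "x \<in> topspace X \<Longrightarrow> \<alpha> g f x = f (\<phi> (inv g) x)"
  by (simp add: induced_action_def)

text \<open>The inverse in the definition of \<open>\<alpha> g f\<close> disappears when the sum is
  reindexed by inversion, so \<open>E f x\<close> is the average of f over the translates of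
  x.\<close>

lemma canonical_expectation_eq:
  assumes "f \<in> carrier C"
  shows "E f = (\<lambda>x. if x \<in> topspace X
    then 1 / of_nat (order G) * (\<Sum>g\<in>carrier G. f (\<phi> g x)) else 0)"
proof -
  have "(\<Sum>g\<in>carrier G. \<alpha> g f x) = (if x \<in> topspace X then \<Sum>g\<in>carrier G. f (\<phi> g x) else 0)" for x
    using sum_group_inv [of "\<lambda>g. f (\<phi> g x)"] by (simp add: induced_action_def)
  then show ?thesis
    using assms finite_group
    by (auto simp: canonical_expectation_def cont_algebra_finsum induced_action_closed)
qed

lemma canonical_expectation_apply:
  assumes "f \<in> carrier C" "x \<in> topspace X"
  shows "E f x = 1 / of_nat (order G) * (\<Sum>g\<in>carrier G. f (\<phi> g x))"
  using assms by (simp add: canonical_expectation_eq)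

lemma canonical_expectation_closed: "f \<in> carrier C \<Longrightarrow> E f \<in> carrier C"
  using finite_group
  by (simp add: canonical_expectation_def cont_algebra_finsum induced_action_closed
      cont_algebra_sum_closed cont_algebra_scale_closed del: times_divide_eq_left)

lemma fixed_point_algebra_iff:
  "f \<in> fixed_point_algebra C G \<alpha> \<longleftrightarrow>
    f \<in> carrier C \<and> (\<forall>g\<in>carrier G. \<forall>x\<in>topspace X. f (\<phi> g x) = f x)"
proof -
  have "(\<forall>g\<in>carrier G. \<alpha> g f = f) \<longleftrightarrow> (\<forall>g\<in>carrier G. \<forall>x\<in>topspace X. f (\<phi> g x) = f x)"
    if f: "f \<in> carrier C"
  proof
    assume L: "\<forall>g\<in>carrier G. \<alpha> g f = f"
    show "\<forall>g\<in>carrier G. \<forall>x\<in>topspace X. f (\<phi> g x) = f x"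
      using L by (metis induced_action_apply inv_closed inv_inv)
  next
    assume "\<forall>g\<in>carrier G. \<forall>x\<in>topspace X. f (\<phi> g x) = f x"
    then show "\<forall>g\<in>carrier G. \<alpha> g f = f"
      using cont_algebra_outside [OF f] by (auto simp: induced_action_def)
  qed
  then show ?thesis
    by (auto simp: fixed_point_algebra_def)
qed

text \<open>The algebraic closure properties are pointwise. For norm closedness, let an invariant s
  be uniformly within \<open>\<epsilon> / 2\<close> of f: then \<open>f (\<phi> g x)\<close> and
  \<open>f x\<close> are both that close to the common value of s, hence within
  \<open>\<epsilon>\<close> of each other.\<close>

lemma fixed_points_subalgebra: "unital_cstar_subalgebra C (fixed_point_algebra C G \<alpha>)"
proof -
  have "f \<in> fixed_point_algebra C G \<alpha>"
    if f: "f \<in> carrier C"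
      and lim: "\<And>\<epsilon>. \<epsilon> > 0 \<Longrightarrow> \<exists>s\<in>fixed_point_algebra C G \<alpha>. \<parallel>f \<ominus>\<^bsub>C\<^esub> s\<parallel>\<^bsub>C\<^esub> < \<epsilon>"
    for f
  proof -
    have "f (\<phi> g x) = f x" if gx: "g \<in> carrier G" "x \<in> topspace X" for g x
    proof -
      \<comment> \<open>The summand 0 gives the bound the shape that \<open>field_le_epsilon\<close>
        expects.\<close>
      have "dist (f (\<phi> g x)) (f x) \<le> 0 + \<epsilon>" if "\<epsilon> > 0" for \<epsilon>
      proof -
        obtain s where s: "s \<in> fixed_point_algebra C G \<alpha>" "\<parallel>f \<ominus>\<^bsub>C\<^esub> s\<parallel>\<^bsub>C\<^esub> < \<epsilon> / 2"
          using lim [OF half_gt_zero [OF \<open>\<epsilon> > 0\<close>]] by blast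
        have sC: "s \<in> carrier C" and inv: "s (\<phi> g x) = s x"
          using s gx by (auto simp: fixed_point_algebra_iff)
        have "f \<ominus>\<^bsub>C\<^esub> s \<in> carrier C"
          using f sC cont_algebra_abelian_group abelian_group.minus_closed by metis
        then have "cmod (f y - s y) < \<epsilon> / 2" for y
          using cont_algebra_norm_upper [OF compact, of "f \<ominus>\<^bsub>C\<^esub> s" y] s(2)
            cont_algebra_minus [OF f sC] by auto
        from this [of x] this [of "\<phi> g x"] inv show ?thesis
          unfolding dist_norm
          using norm_triangle_ineq4 [of "f (\<phi> g x) - s x" "f x - s x"] by simp
      qed
      then show ?thesis
        using field_le_epsilon [of "dist (f (\<phi> g x)) (f x)" 0] by simp
    qed
    with f show ?thesis
      by (simp add: fixed_point_algebra_iff)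
  qed
  then have "norm_closed C (fixed_point_algebra C G \<alpha>)"
    by (auto simp: norm_closed_def)
  then show ?thesis
    by (auto simp: unital_cstar_subalgebra_def fixed_point_algebra_iff action_closed
        cont_algebra_one_closed cont_algebra_add_closed cont_algebra_mult_closed
        cont_algebra_scale_closed cont_algebra_cnj_closed)
qed

text \<open>Evaluating the average at \<open>\<phi> h x\<close> multiplies the summation index by h
  on the right, which only permutes G.\<close>

lemma canonical_expectation_fixed:
  assumes "f \<in> carrier C"
  shows "E f \<in> fixed_point_algebra C G \<alpha>"
proof -
  have "E f (\<phi> h x) = E f x" if "h \<in> carrier G" "x \<in> topspace X" for h x
    using that sum_group_right [of h "\<lambda>g. f (\<phi> g x)"]
    by (simp add: canonical_expectation_apply [OF assms] action_closed
        composition_rule [symmetric])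
  then show ?thesis
    using assms by (simp add: fixed_point_algebra_iff canonical_expectation_closed)
qed

text \<open>Up to the factor 1/|G|, the hypothesis at x says that the nonnegative reals
  \<open>(cmod (b (\<phi> g x)))\<^sup>2\<close> sum to 0. Hence each of them vanishes, in
  particular the one at \<open>g = \<one>\<close>.\<close>

lemma canonical_expectation_faithful:
  assumes b: "b \<in> carrier C" and 0: "E (\<lambda>x. cnj (b x) * b x) = (\<lambda>x. 0)"
  shows "b = (\<lambda>x. 0)"
proof
  fix x
  show "b x = 0"
  proof (cases "x \<in> topspace X")
    case True
    have "(\<Sum>g\<in>carrier G. cnj (b (\<phi> g x)) * b (\<phi> g x)) = 0"
      using fun_cong [OF 0, of x] True order_nonzero b
      by (simp add: canonical_expectation_apply cont_algebra_mult_closed cont_algebra_cnj_closed)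
    also have "(\<Sum>g\<in>carrier G. cnj (b (\<phi> g x)) * b (\<phi> g x)) =
        of_real (\<Sum>g\<in>carrier G. (cmod (b (\<phi> g x)))\<^sup>2)"
      by (simp only: of_real_sum complex_norm_square mult.commute)
    finally have "(\<Sum>g\<in>carrier G. (cmod (b (\<phi> g x)))\<^sup>2) = 0"
      by (simp only: of_real_eq_0_iff)
    then have "\<forall>g\<in>carrier G. (cmod (b (\<phi> g x)))\<^sup>2 = 0"
      by (subst (asm) sum_nonneg_eq_0_iff) (use finite_group in auto)
    then have "(cmod (b (\<phi> \<one> x)))\<^sup>2 = 0"
      by (rule bspec) simp
    then show ?thesis
      using True by (simp add: action_one)
  qed (simp add: cont_algebra_outside [OF b])
qed

lemma canonical_expectation_faithful_conditional:
  "faithful_conditional_expectation C (fixed_point_algebra C G \<alpha>) E"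
  unfolding faithful_conditional_expectation_def
proof (intro conjI ballI allI impI)
  show "E \<in> carrier C \<rightarrow> fixed_point_algebra C G \<alpha>"
    using canonical_expectation_fixed by blast
next
  fix a b assume "a \<in> carrier C" "b \<in> carrier C"
  then show "E (a \<oplus>\<^bsub>C\<^esub> b) = E a \<oplus>\<^bsub>C\<^esub> E b"
    by (auto simp: canonical_expectation_eq cont_algebra_add_closed sum.distrib add_divide_distrib)
next
  fix z b assume "b \<in> carrier C"
  then show "E (z \<odot>\<^bsub>C\<^esub> b) = z \<odot>\<^bsub>C\<^esub> E b"
    by (auto simp: canonical_expectation_eq cont_algebra_scale_closed sum_distrib_left)
next
  fix c assume "c \<in> fixed_point_algebra C G \<alpha>"
  then show "E c = c"
    using order_nonzero cont_algebra_outside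
    by (force simp: fixed_point_algebra_iff canonical_expectation_eq order_def)
next
  fix c b assume c: "c \<in> fixed_point_algebra C G \<alpha>" and b: "b \<in> carrier C"
  \<comment> \<open>An invariant c is constant on orbits and can be pulled out of the orbit
    average.\<close>
  show "E (c \<otimes>\<^bsub>C\<^esub> b) = c \<otimes>\<^bsub>C\<^esub> E b"
    using b c
    by (auto simp: fixed_point_algebra_iff canonical_expectation_eq cont_algebra_mult_closed
        sum_distrib_left)
  then show "E (b \<otimes>\<^bsub>C\<^esub> c) = E b \<otimes>\<^bsub>C\<^esub> c"
    by (simp add: mult.commute)
next
  fix p assume "p \<in> positive_elements C"
  then show "E p \<in> positive_elements C"
    using canonical_expectation_closed
    by (auto simp: cont_algebra_positive_iff canonical_expectation_eq
        simp: complex_nonneg_Reals_iff intro!: divide_nonneg_nonneg sum_nonneg)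
next
  fix b assume "b \<in> carrier C" "E ((\<sharp>\<^bsub>C\<^esub> b) \<otimes>\<^bsub>C\<^esub> b) = \<zero>\<^bsub>C\<^esub>"
  then show "b = \<zero>\<^bsub>C\<^esub>"
    using canonical_expectation_faithful by simp
qed (rule fixed_points_subalgebra)

section \<open>Orbit frames of a free action\<close>

lemma free_action_bump:
  assumes "free_action X G \<phi>" and x: "x \<in> topspace X"
  obtains w :: "'a \<Rightarrow> real" where "continuous_map X euclideanreal w" "w x \<noteq> 0"
    "\<And>g y. g \<in> carrier G \<Longrightarrow> g \<noteq> \<one> \<Longrightarrow> y \<in> topspace X \<Longrightarrow> w y * w (\<phi> g y) = 0"
proof -
  let ?G = "carrier G - {\<one>}"
  let ?F = "(\<lambda>g. \<phi> g x) ` ?G"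
  have "finite ?F" "?F \<subseteq> topspace X" "x \<notin> ?F"
    using assms finite_group action_closed by (force simp: free_action_def)+
  then obtain f where f: "continuous_map X euclideanreal f" "f x = 1" "\<And>y. y \<in> ?F \<Longrightarrow> f y = 0"
    using compact_Hausdorff_separates_from_finite [OF compact Hausdorff x] by metis
  \<comment> \<open>By freeness f is 1 at x and 0 at all other translates of x. The function w is
    nonzero exactly where f exceeds 1/2 at y and is below 1/2 at every translate of y by
    \<open>g \<noteq> \<one>\<close>. So \<open>w y\<close> and \<open>w (\<phi> g y)\<close> cannot
    both be nonzero: they put contradictory conditions on \<open>f (\<phi> g y)\<close>.\<close>
  define w where "w y = max 0 (f y - 1/2) * (\<Prod>g\<in>?G. max 0 (1/2 - f (\<phi> g y)))" for y
  show ?thesis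
  proof
    have f\<phi>: "continuous_map X euclideanreal (\<lambda>y. f (\<phi> g y))" if "g \<in> carrier G" for g
      using continuous_map_compose [OF continuous [OF that] f(1)] by (simp add: o_def)
    show "continuous_map X euclideanreal w"
      using f(1) f\<phi> unfolding w_def continuous_map_atin limitin_canonical_iff
      by (intro ballI tendsto_intros) auto
    show "w x \<noteq> 0"
      using f finite_group by (auto simp: w_def)
    show "w y * w (\<phi> g y) = 0" if g: "g \<in> carrier G" "g \<noteq> \<one>" and y: "y \<in> topspace X" for g y
    proof (cases "f (\<phi> g y) \<le> 1/2")
      case True
      then show ?thesis by (simp add: w_def)
    next
      case False
      then have "w y = 0"
        using g finite_group by (auto simp: w_def intro!: bexI [of _ g])
      then show ?thesis by simp
    qed
  qed
qed

text \<open>With V(y) the vector of all \<open>v i y\<close>, the condition says that the vectors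
  V(gx), for g in G, are pairwise orthogonal of squared length |G|. Both the quasi-basis identities
  and the decomposition of the unit of the crossed product follow from it.\<close>

definition orbit_frame :: "nat \<Rightarrow> (nat \<Rightarrow> 'a \<Rightarrow> complex) \<Rightarrow> bool" where
  "orbit_frame n v \<longleftrightarrow> (\<forall>i<n. v i \<in> carrier C) \<and>
    (\<forall>x\<in>topspace X. \<forall>g\<in>carrier G.
      (\<Sum>i<n. v i x * cnj (v i (\<phi> g x))) = (if g = \<one> then of_nat (order G) else 0))"

lemma orbit_frame_closed: "orbit_frame n v \<Longrightarrow> i < n \<Longrightarrow> v i \<in> carrier C"
  by (simp add: orbit_frame_def)

lemma orbit_frame_sum:
  "orbit_frame n v \<Longrightarrow> x \<in> topspace X \<Longrightarrow> g \<in> carrier G \<Longrightarrow>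
    (\<Sum>i<n. v i x * cnj (v i (\<phi> g x))) = (if g = \<one> then of_nat (order G) else 0)"
  by (simp add: orbit_frame_def)

text \<open>Finitely many bump functions have no common zero, by compactness. Dividing them by the
  root of the sum S of their squares gives a partition of unity by squares, which settles
  \<open>g = \<one>\<close>; for the other g each product vanishes by the choice of the
  bumps.\<close>

lemma free_action_orbit_frame:
  assumes "free_action X G \<phi>"
  obtains n v where "orbit_frame n v"
proof -
  have "\<exists>w. continuous_map X euclideanreal w \<and> w x \<noteq> 0 \<and>
    (\<forall>g\<in>carrier G. g \<noteq> \<one> \<longrightarrow> (\<forall>y\<in>topspace X. w y * w (\<phi> g y) = 0))"
    if "x \<in> topspace X" for x
    using free_action_bump [OF assms that] by metis
  then obtain W where W: "\<And>x. x \<in> topspace X \<Longrightarrow> continuous_map X euclideanreal (W x)"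
    "\<And>x. x \<in> topspace X \<Longrightarrow> W x x \<noteq> 0"
    "\<And>x g y. x \<in> topspace X \<Longrightarrow> g \<in> carrier G \<Longrightarrow> g \<noteq> \<one> \<Longrightarrow> y \<in> topspace X \<Longrightarrow> W x y * W x (\<phi> g y) = 0"
    by metis
  define U where "U x = {y \<in> topspace X. W x y \<in> - {0}}" for x
  have "openin X (U x)" if "x \<in> topspace X" for x
    unfolding U_def by (rule openin_continuous_map_preimage [OF W(1) [OF that]]) auto
  moreover have "topspace X \<subseteq> \<Union> (U ` topspace X)"
    using W(2) by (auto simp: U_def)
  ultimately obtain \<F> where "finite \<F>" "\<F> \<subseteq> U ` topspace X" "topspace X \<subseteq> \<Union>\<F>"
    using compact unfolding compact_space_def compactin_def by (metis imageE)
  then obtain T where T: "T \<subseteq> topspace X" "finite T" "topspace X \<subseteq> \<Union> (U ` T)"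
    by (metis finite_subset_image)
  define S where "S y = (\<Sum>x\<in>T. (W x y)\<^sup>2)" for y
  have S: "S y > 0" if "y \<in> topspace X" for y
  proof -
    from T(3) that obtain x where "x \<in> T" "y \<in> U x"
      by blast
    then have "x \<in> T" "W x y \<noteq> 0"
      by (simp_all add: U_def)
    then show ?thesis
      unfolding S_def using T(2) by (intro sum_pos2) auto
  qed
  have W_cont: "continuous_map X euclideanreal (W x)" if "x \<in> T" for x
    using W(1) T(1) that by blast
  \<comment> \<open>Frames are indexed by an initial segment of the naturals, so the finite set T of
    centres is enumerated.\<close>
  obtain t where t: "bij_betw t {..<card T} T"
    using ex_bij_betw_nat_finite [OF T(2)] by (auto simp: atLeast0LessThan)
  \<comment> \<open>The factor is chosen so that the squares sum to |G| at each point of X; there S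
    is positive, hence the quotient is continuous.\<close>
  define u where "u x y = sqrt (order G) * W x y / sqrt (S y)" for x y
  define v where "v i y = (if y \<in> topspace X then complex_of_real (u (t i) y) else 0)" for i y
  show ?thesis
  proof (rule that, unfold orbit_frame_def, intro conjI allI impI ballI)
    fix i assume i: "i < card T"
    then have tT: "t i \<in> T"
      using t by (auto dest: bij_betwE)
    have "continuous_map X euclideanreal S"
      unfolding S_def using W_cont unfolding continuous_map_atin limitin_canonical_iff
      by (intro ballI tendsto_intros) auto
    then have "continuous_map X euclidean (\<lambda>y. complex_of_real (u (t i) y))"
      using W_cont [OF tT] S
      unfolding u_def continuous_map_atin limitin_canonical_iff
      by (intro ballI tendsto_intros) (auto dest: less_imp_neq [THEN not_sym])
    then show "v i \<in> carrier C"
      unfolding v_def by (rule continuous_map_into_cont_algebra)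
  next
    fix x g assume x: "x \<in> topspace X" and g: "g \<in> carrier G"
    have "(\<Sum>i<card T. v i x * cnj (v i (\<phi> g x))) =
        of_real (\<Sum>i<card T. u (t i) x * u (t i) (\<phi> g x))"
      using x g by (simp add: v_def action_closed)
    also have "(\<Sum>i<card T. u (t i) x * u (t i) (\<phi> g x)) = (\<Sum>z\<in>T. u z x * u z (\<phi> g x))"
      by (rule sum.reindex_bij_betw [OF t])
    also have "\<dots> = (if g = \<one> then order G else 0)"
    proof (cases "g = \<one>")
      case True
      have "(\<Sum>z\<in>T. u z x * u z (\<phi> g x)) = (\<Sum>z\<in>T. order G / S x * (W z x)\<^sup>2)"
        using S [OF x] x True
        by (intro sum.cong refl) (simp add: u_def action_one power2_eq_square)
      also have "\<dots> = order G / S x * S x"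
        by (simp only: S_def sum_distrib_left)
      finally show ?thesis
        using S [OF x] True by simp
    next
      case False
      have "u z x * u z (\<phi> g x) = 0" if "z \<in> T" for z
        using W(3) [of z g x] T(1) that g False x by (auto simp: u_def)
      then have "(\<Sum>z\<in>T. u z x * u z (\<phi> g x)) = 0"
        by (intro sum.neutral ballI)
      then show ?thesis
        using False by simp
    qed
    finally show "(\<Sum>i<card T. v i x * cnj (v i (\<phi> g x))) = (if g = \<one> then of_nat (order G) else 0)"
      by simp
  qed
qed

section \<open>Quasi-bases\<close>

lemma quasi_basis_iff:
  "quasi_basis C E n v \<longleftrightarrow>
    (\<forall>i<n. v i \<in> carrier C) \<and>
    (\<forall>b\<in>carrier C.
      b = (\<lambda>x. \<Sum>i<n. E (\<lambda>x. b x * v i x) x * cnj (v i x)) \<and>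
      b = (\<lambda>x. \<Sum>i<n. v i x * E (\<lambda>x. cnj (v i x) * b x) x))"
proof -
  have "(\<Oplus>\<^bsub>C\<^esub>i\<in>{..<n}. E (b \<otimes>\<^bsub>C\<^esub> v i) \<otimes>\<^bsub>C\<^esub> (\<sharp>\<^bsub>C\<^esub> (v i))) =
        (\<lambda>x. \<Sum>i<n. E (\<lambda>x. b x * v i x) x * cnj (v i x))"
    "(\<Oplus>\<^bsub>C\<^esub>i\<in>{..<n}. v i \<otimes>\<^bsub>C\<^esub> E ((\<sharp>\<^bsub>C\<^esub> (v i)) \<otimes>\<^bsub>C\<^esub> b)) =
        (\<lambda>x. \<Sum>i<n. v i x * E (\<lambda>x. cnj (v i x) * b x) x)"
    if "\<forall>i<n. v i \<in> carrier C" "b \<in> carrier C" for b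
    using that unfolding cont_algebra_simps
    by (intro cont_algebra_finsum; auto intro!: cont_algebra_mult_closed
        cont_algebra_cnj_closed canonical_expectation_closed)+
  then show ?thesis
    unfolding quasi_basis_def by (auto simp: Pi_iff)
qed

text \<open>Writing E as an orbit average and exchanging the two sums isolates the kernel of the
  family. Both implications between freeness and the index are read off from this formula.\<close>

lemma quasi_basis_expansion:
  assumes v: "\<And>i. i < (n::nat) \<Longrightarrow> v i \<in> carrier C" and b: "b \<in> carrier C" and x: "x \<in> topspace X"
  shows "(\<Sum>i<n. v i x * E (\<lambda>x. cnj (v i x) * b x) x) =
    1 / of_nat (order G) * (\<Sum>g\<in>carrier G. (\<Sum>i<n. v i x * cnj (v i (\<phi> g x))) * b (\<phi> g x))"
proof -
  have "(\<Sum>i<n. v i x * E (\<lambda>x. cnj (v i x) * b x) x) =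
      (\<Sum>i<n. \<Sum>g\<in>carrier G. 1 / of_nat (order G) * (v i x * cnj (v i (\<phi> g x)) * b (\<phi> g x)))"
    using v b x
    by (intro sum.cong) (auto simp: canonical_expectation_apply cont_algebra_mult_closed
        cont_algebra_cnj_closed sum_distrib_left mult_ac)
  also have "\<dots> = (\<Sum>g\<in>carrier G. \<Sum>i<n. 1 / of_nat (order G) * (v i x * cnj (v i (\<phi> g x)) * b (\<phi> g x)))"
    by (rule sum.swap)
  finally show ?thesis
    by (simp only: sum_distrib_left sum_distrib_right)
qed

lemma cnj_canonical_expectation:
  assumes "f \<in> carrier C"
  shows "cnj (E f x) = E (\<lambda>x. cnj (f x)) x"
  using assms by (simp add: canonical_expectation_eq cont_algebra_cnj_closed)

text \<open>In the expansion the kernel keeps only the term at \<open>g = \<one>\<close>, which is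
  |G| times \<open>b x\<close>, and |G| cancels against the factor of E.\<close>

lemma orbit_frame_quasi_basis:
  assumes frame: "orbit_frame n v"
  shows "quasi_basis C E n v"
proof -
  note v = orbit_frame_closed [OF frame]
  have expand: "(\<Sum>i<n. v i x * E (\<lambda>x. cnj (v i x) * b x) x) = b x" if b: "b \<in> carrier C" for b x
  proof (cases "x \<in> topspace X")
    case True
    have "(\<Sum>g\<in>carrier G. (\<Sum>i<n. v i x * cnj (v i (\<phi> g x))) * b (\<phi> g x)) =
        (\<Sum>g\<in>carrier G. if g = \<one> then of_nat (order G) * b (\<phi> g x) else 0)"
      using orbit_frame_sum [OF frame True] by (intro sum.cong) auto
    also have "\<dots> = of_nat (order G) * b x"
      using finite_group True by (simp add: action_one)
    finally show ?thesis
      using quasi_basis_expansion [OF v b True] order_nonzero by simp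
  next
    case False
    then show ?thesis
      using cont_algebra_outside [OF v] cont_algebra_outside [OF b] by simp
  qed
  \<comment> \<open>The second identity is the conjugate of the first one for \<open>cnj b\<close>,
    since E commutes with conjugation.\<close>
  have "(\<Sum>i<n. E (\<lambda>x. b x * v i x) x * cnj (v i x)) = b x" if b: "b \<in> carrier C" for b x
  proof -
    have "(\<Sum>i<n. E (\<lambda>x. b x * v i x) x * cnj (v i x)) =
        cnj (\<Sum>i<n. v i x * E (\<lambda>x. cnj (v i x) * cnj (b x)) x)"
      using v b by (simp add: cnj_canonical_expectation cont_algebra_mult_closed
          cont_algebra_cnj_closed mult_ac)
    also have "\<dots> = b x"
      using expand [OF cont_algebra_cnj_closed [OF b]] by simp
    finally show ?thesis .
  qed
  with expand v show ?thesis
    by (simp add: quasi_basis_iff)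
qed

text \<open>Expand each \<open>cnj (u j)\<close> in the quasi-basis v, exchange the sums, and
  recognize the inner sum over j as the expansion of \<open>v i\<close> in the quasi-basis
  u.\<close>

lemma quasi_basis_index_unique:
  assumes u: "quasi_basis C E m u" and v: "quasi_basis C E n v"
  shows "(\<Sum>j<m. u j x * cnj (u j x)) = (\<Sum>i<n. v i x * cnj (v i x))"
proof -
  have uC: "\<And>j. j < m \<Longrightarrow> u j \<in> carrier C" and vC: "\<And>i. i < n \<Longrightarrow> v i \<in> carrier C"
    using u v by (auto simp: quasi_basis_iff)
  have "(\<Sum>j<m. u j x * cnj (u j x)) =
      (\<Sum>j<m. u j x * (\<Sum>i<n. E (\<lambda>x. cnj (u j x) * v i x) x * cnj (v i x)))"
  proof (intro sum.cong refl arg_cong2 [where f = "(*)"])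
    fix j assume "j \<in> {..<m}"
    then have "(\<lambda>x. cnj (u j x)) \<in> carrier C"
      using uC cont_algebra_cnj_closed by auto
    with v have "(\<lambda>x. cnj (u j x)) = (\<lambda>x. \<Sum>i<n. E (\<lambda>x. cnj (u j x) * v i x) x * cnj (v i x))"
      unfolding quasi_basis_iff by blast
    then show "cnj (u j x) = (\<Sum>i<n. E (\<lambda>x. cnj (u j x) * v i x) x * cnj (v i x))"
      by (rule fun_cong)
  qed
  also have "\<dots> = (\<Sum>j<m. \<Sum>i<n. u j x * E (\<lambda>x. cnj (u j x) * v i x) x * cnj (v i x))"
    by (simp only: sum_distrib_left mult.assoc)
  also have "\<dots> = (\<Sum>i<n. \<Sum>j<m. u j x * E (\<lambda>x. cnj (u j x) * v i x) x * cnj (v i x))"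
    by (rule sum.swap)
  also have "\<dots> = (\<Sum>i<n. (\<Sum>j<m. u j x * E (\<lambda>x. cnj (u j x) * v i x) x) * cnj (v i x))"
    by (simp only: sum_distrib_right)
  also have "\<dots> = (\<Sum>i<n. v i x * cnj (v i x))"
  proof (intro sum.cong refl arg_cong2 [where f = "(*)"])
    fix i assume "i \<in> {..<n}"
    with u vC have "v i = (\<lambda>x. \<Sum>j<m. u j x * E (\<lambda>x. cnj (u j x) * v i x) x)"
      unfolding quasi_basis_iff by blast
    then show "(\<Sum>j<m. u j x * E (\<lambda>x. cnj (u j x) * v i x) x) = v i x"
      by (rule fun_cong [symmetric])
  qed
  finally show ?thesis .
qed

text \<open>Independence of the quasi-basis gives the definite description in
  \<open>expectation_index\<close> a unique candidate, so any quasi-basis computes it.\<close>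

lemma expectation_index_eq:
  assumes v: "quasi_basis C E n v"
  shows "expectation_index C E = (\<lambda>x. \<Sum>i<n. v i x * cnj (v i x))"
proof -
  have index: "(\<Oplus>\<^bsub>C\<^esub>i\<in>{..<m}. u i \<otimes>\<^bsub>C\<^esub> (\<sharp>\<^bsub>C\<^esub> (u i))) = (\<lambda>x. \<Sum>i<m. u i x * cnj (u i x))"
    if "quasi_basis C E m u" for m u
    using that unfolding cont_algebra_simps quasi_basis_iff
    by (intro cont_algebra_finsum) (auto intro!: cont_algebra_mult_closed cont_algebra_cnj_closed)
  show ?thesis
    unfolding expectation_index_def
  proof (rule the_equality)
    show "\<exists>m u. quasi_basis C E m u \<and>
        (\<lambda>x. \<Sum>i<n. v i x * cnj (v i x)) = (\<Oplus>\<^bsub>C\<^esub>i\<in>{..<m}. u i \<otimes>\<^bsub>C\<^esub> (\<sharp>\<^bsub>C\<^esub> (u i)))"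
      using v by (intro exI [of _ n] exI [of _ v]) (simp only: index [OF v])
    fix z assume "\<exists>m u. quasi_basis C E m u \<and> z = (\<Oplus>\<^bsub>C\<^esub>i\<in>{..<m}. u i \<otimes>\<^bsub>C\<^esub> (\<sharp>\<^bsub>C\<^esub> (u i)))"
    then obtain m u where u: "quasi_basis C E m u"
      and z: "z = (\<Oplus>\<^bsub>C\<^esub>i\<in>{..<m}. u i \<otimes>\<^bsub>C\<^esub> (\<sharp>\<^bsub>C\<^esub> (u i)))"
      by blast
    show "z = (\<lambda>x. \<Sum>i<n. v i x * cnj (v i x))"
      unfolding z index [OF u] using quasi_basis_index_unique [OF u v] by (rule ext)
  qed
qed

section \<open>Freeness and the index\<close>

lemma free_action_imp_index_finite:
  assumes "free_action X G \<phi>"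
  shows "index_finite_type C (fixed_point_algebra C G \<alpha>) E \<and>
    expectation_index C E = of_nat (order G) \<odot>\<^bsub>C\<^esub> \<one>\<^bsub>C\<^esub>"
proof -
  obtain n v where frame: "orbit_frame n v"
    by (rule free_action_orbit_frame [OF assms])
  note qb = orbit_frame_quasi_basis [OF frame]
  \<comment> \<open>The frame condition at \<open>g = \<one>\<close> is the value of the index on X;
    off X all \<open>v i\<close> vanish.\<close>
  have "(\<Sum>i<n. v i x * cnj (v i x)) = (if x \<in> topspace X then of_nat (order G) else 0)" for x
    using orbit_frame_sum [OF frame, of x \<one>]
      cont_algebra_outside [OF orbit_frame_closed [OF frame], of _ x]
    by (simp add: action_one)
  then have "expectation_index C E = of_nat (order G) \<odot>\<^bsub>C\<^esub> \<one>\<^bsub>C\<^esub>"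
    by (auto simp: expectation_index_eq [OF qb])
  with qb show ?thesis
    using canonical_expectation_faithful_conditional by (auto simp: index_finite_type_def)
qed

text \<open>For b equal to 1 at x and 0 on the rest of the orbit, the expansion at x has one term
  for each element of the stabilizer \<open>?H\<close>, each with the kernel value |G|. It becomes 1
  = (1/|G|) |G| |H|, so the stabilizer has one element.\<close>

lemma index_finite_imp_free_action:
  assumes "index_finite_type C (fixed_point_algebra C G \<alpha>) E"
    and index: "expectation_index C E = of_nat (order G) \<odot>\<^bsub>C\<^esub> \<one>\<^bsub>C\<^esub>"
  shows "free_action X G \<phi>"
  unfolding free_action_def
proof (intro ballI impI notI)
  fix x h assume x: "x \<in> topspace X" and h: "h \<in> carrier G" "h \<noteq> \<one>" "\<phi> h x = x"
  obtain n v where qb: "quasi_basis C E n v"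
    using assms by (auto simp: index_finite_type_def)
  then have v: "\<And>i. i < n \<Longrightarrow> v i \<in> carrier C"
    by (auto simp: quasi_basis_iff)
  have K: "(\<Sum>i<n. v i x * cnj (v i x)) = of_nat (order G)"
    using fun_cong [OF index, of x] x by (simp add: expectation_index_eq [OF qb])
  let ?F = "(\<lambda>g. \<phi> g x) ` carrier G - {x}"
  have "finite ?F" "?F \<subseteq> topspace X" "x \<notin> ?F"
    using x finite_group action_closed by auto
  then obtain f where f: "continuous_map X euclideanreal f" "f x = 1" "\<And>y. y \<in> ?F \<Longrightarrow> f y = 0"
    using compact_Hausdorff_separates_from_finite [OF compact Hausdorff x] by metis
  define b where "b y = (if y \<in> topspace X then complex_of_real (f y) else 0)" for y
  have bC: "b \<in> carrier C"
    unfolding b_def using f(1)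
    by (intro continuous_map_into_cont_algebra) (auto simp: continuous_map_atin intro: tendsto_of_real)
  have b: "b (\<phi> g x) = (if \<phi> g x = x then 1 else 0)" if "g \<in> carrier G" for g
    using f(2,3) x that by (auto simp: b_def action_closed)
  let ?H = "{g \<in> carrier G. \<phi> g x = x}"
  have "b = (\<lambda>x. \<Sum>i<n. v i x * E (\<lambda>x. cnj (v i x) * b x) x)"
    using qb bC unfolding quasi_basis_iff by blast
  then have "b x = (\<Sum>i<n. v i x * E (\<lambda>x. cnj (v i x) * b x) x)"
    by (rule fun_cong)
  also have "\<dots> = 1 / of_nat (order G) *
      (\<Sum>g\<in>carrier G. (\<Sum>i<n. v i x * cnj (v i (\<phi> g x))) * b (\<phi> g x))"
    by (rule quasi_basis_expansion [OF v bC x])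
  also have "(\<Sum>g\<in>carrier G. (\<Sum>i<n. v i x * cnj (v i (\<phi> g x))) * b (\<phi> g x)) =
      (\<Sum>g\<in>carrier G. if \<phi> g x = x then of_nat (order G) else 0)"
    using K b by (intro sum.cong) auto
  also have "\<dots> = of_nat (order G) * of_nat (card ?H)"
    using finite_group by (simp add: sum.If_cases Int_def)
  finally have "of_nat (card ?H) = (1 :: complex)"
    using b [of \<one>] x order_nonzero by (simp add: action_one)
  then have "card ?H = 1"
    using of_nat_eq_1_iff by blast
  then obtain k where "?H = {k}"
    by (rule card_1_singletonE)
  moreover have "h \<in> ?H" "\<one> \<in> ?H"
    using h x by (auto simp: action_one)
  ultimately have "h \<in> {k}" "\<one> \<in> {k}"
    by (simp_all only:)
  then show False
    using h(2) by simp
qed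

section \<open>The crossed product\<close>

lemma crossed_product_simps:
  "carrier CP = carrier G \<rightarrow>\<^sub>E carrier C"
  "a \<otimes>\<^bsub>CP\<^esub> b = (\<lambda>k\<in>carrier G. \<Oplus>\<^bsub>C\<^esub>h\<in>carrier G. a h \<otimes>\<^bsub>C\<^esub> \<alpha> h (b (inv h \<otimes> k)))"
  "\<one>\<^bsub>CP\<^esub> = (\<lambda>k\<in>carrier G. if k = \<one> then \<one>\<^bsub>C\<^esub> else \<zero>\<^bsub>C\<^esub>)"
  "\<zero>\<^bsub>CP\<^esub> = (\<lambda>k\<in>carrier G. \<zero>\<^bsub>C\<^esub>)"
  "a \<oplus>\<^bsub>CP\<^esub> b = (\<lambda>k\<in>carrier G. a k \<oplus>\<^bsub>C\<^esub> b k)"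
  "z \<odot>\<^bsub>CP\<^esub> a = (\<lambda>k\<in>carrier G. z \<odot>\<^bsub>C\<^esub> a k)"
  by (simp_all add: crossed_product_def)

lemma crossed_product_norm:
  "\<parallel>a\<parallel>\<^bsub>CP\<^esub> = Sup {l2_norm C G (regular_rep C G \<alpha> a \<xi>) | \<xi>.
      \<xi> \<in> carrier CP \<and> l2_norm C G \<xi> \<le> 1}"
  by (simp add: crossed_product_def)

lemma crossed_product_coeff: "a \<in> carrier CP \<Longrightarrow> k \<in> carrier G \<Longrightarrow> a k \<in> carrier C"
  by (auto simp: crossed_product_simps)

text \<open>Coefficient functions are undefined off G by extensionality and their values vanish off
  X, so comparing them on G and X suffices.\<close>

lemma crossed_product_eqI:
  assumes a: "a \<in> carrier CP" and b: "b \<in> carrier CP"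
    and eq: "\<And>k x. k \<in> carrier G \<Longrightarrow> x \<in> topspace X \<Longrightarrow> a k x = b k x"
  shows "a = b"
proof (rule extensionalityI [where A = "carrier G"])
  show "a k = b k" if k: "k \<in> carrier G" for k
  proof
    fix x
    show "a k x = b k x"
      using eq [OF k] cont_algebra_outside [OF crossed_product_coeff [OF a k]]
        cont_algebra_outside [OF crossed_product_coeff [OF b k]] by (cases "x \<in> topspace X") auto
  qed
qed (use a b in \<open>auto simp: crossed_product_simps PiE_def\<close>)

lemma crossed_product_mult_eq:
  assumes "a \<in> carrier CP" "b \<in> carrier CP"
  shows "a \<otimes>\<^bsub>CP\<^esub> b =
    (\<lambda>k\<in>carrier G. \<lambda>x. \<Sum>h\<in>carrier G. a h x * \<alpha> h (b (inv h \<otimes> k)) x)"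
  unfolding crossed_product_simps cont_algebra_simps
  using assms
  by (intro restrict_ext cont_algebra_finsum finite_group cont_algebra_mult_closed
      induced_action_closed) (auto intro: crossed_product_coeff)

lemma crossed_product_mult_closed:
  assumes "a \<in> carrier CP" "b \<in> carrier CP"
  shows "a \<otimes>\<^bsub>CP\<^esub> b \<in> carrier CP"
  unfolding crossed_product_mult_eq [OF assms] crossed_product_simps(1)
  using assms
  by (intro restrict_PiE_iff [THEN iffD2] ballI cont_algebra_sum_closed finite_group cont_algebra_mult_closed
      induced_action_closed) (auto intro: crossed_product_coeff)

lemma crossed_product_mult_apply:
  assumes "a \<in> carrier CP" "b \<in> carrier CP" "k \<in> carrier G" "x \<in> topspace X"
  shows "(a \<otimes>\<^bsub>CP\<^esub> b) k x = (\<Sum>h\<in>carrier G. a h x * b (inv h \<otimes> k) (\<phi> (inv h) x))"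
  using assms by (simp add: crossed_product_mult_eq induced_action_apply)

lemma crossed_product_add_closed:
  "a \<in> carrier CP \<Longrightarrow> b \<in> carrier CP \<Longrightarrow> a \<oplus>\<^bsub>CP\<^esub> b \<in> carrier CP"
  by (auto simp: crossed_product_simps intro!: cont_algebra_add_closed)

lemma crossed_product_uminus_closed:
  "a \<in> carrier CP \<Longrightarrow> (\<lambda>k\<in>carrier G. \<lambda>x. - a k x) \<in> carrier CP"
  by (auto simp: crossed_product_simps intro!: cont_algebra_uminus_closed)

lemma crossed_product_zero_closed: "\<zero>\<^bsub>CP\<^esub> \<in> carrier CP"
  by (auto simp: crossed_product_simps cont_algebra_zero_closed)

lemma crossed_product_one_closed: "\<one>\<^bsub>CP\<^esub> \<in> carrier CP"
  by (auto simp: crossed_product_simps cont_algebra_zero_closed cont_algebra_one_closed)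

lemma crossed_product_add_apply: "k \<in> carrier G \<Longrightarrow> (a \<oplus>\<^bsub>CP\<^esub> b) k x = a k x + b k x"
  by (simp add: crossed_product_simps)

lemma crossed_product_abelian_group: "abelian_group CP"
proof (rule abelian_groupI)
  show "\<exists>b\<in>carrier CP. b \<oplus>\<^bsub>CP\<^esub> a = \<zero>\<^bsub>CP\<^esub>" if "a \<in> carrier CP" for a
    by (rule bexI [OF _ crossed_product_uminus_closed [OF that]])
      (auto simp: crossed_product_simps intro: restrict_ext)
  show "\<zero>\<^bsub>CP\<^esub> \<oplus>\<^bsub>CP\<^esub> a = a" if "a \<in> carrier CP" for a
    using that by (intro crossed_product_eqI crossed_product_add_closed crossed_product_zero_closed)
      (auto simp: crossed_product_simps)
  show "a \<oplus>\<^bsub>CP\<^esub> b \<oplus>\<^bsub>CP\<^esub> c = a \<oplus>\<^bsub>CP\<^esub> (b \<oplus>\<^bsub>CP\<^esub> c)" for a b c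
    by (auto simp: crossed_product_simps(5) add.assoc intro: restrict_ext)
  show "a \<oplus>\<^bsub>CP\<^esub> b = b \<oplus>\<^bsub>CP\<^esub> a" for a b
    by (auto simp: crossed_product_simps(5) add.commute intro: restrict_ext)
qed (simp_all only: crossed_product_add_closed crossed_product_zero_closed)

text \<open>After the sums are exchanged, replacing h by \<open>l \<otimes> h\<close> turns the
  inner sum into the convolution of b and c at the point translated by \<open>inv l\<close>.\<close>

lemma crossed_product_mult_assoc:
  assumes a: "a \<in> carrier CP" and b: "b \<in> carrier CP" and c: "c \<in> carrier CP"
  shows "(a \<otimes>\<^bsub>CP\<^esub> b) \<otimes>\<^bsub>CP\<^esub> c = a \<otimes>\<^bsub>CP\<^esub> (b \<otimes>\<^bsub>CP\<^esub> c)"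
proof (intro crossed_product_eqI crossed_product_mult_closed a b c)
  fix k x assume k: "k \<in> carrier G" and x: "x \<in> topspace X"
  have "((a \<otimes>\<^bsub>CP\<^esub> b) \<otimes>\<^bsub>CP\<^esub> c) k x =
      (\<Sum>h\<in>carrier G. \<Sum>l\<in>carrier G.
        a l x * b (inv l \<otimes> h) (\<phi> (inv l) x) * c (inv h \<otimes> k) (\<phi> (inv h) x))"
    using a b c k x
    by (simp add: crossed_product_mult_apply crossed_product_mult_closed sum_distrib_right)
  also have "\<dots> = (\<Sum>l\<in>carrier G. \<Sum>h\<in>carrier G.
        a l x * b (inv l \<otimes> h) (\<phi> (inv l) x) * c (inv h \<otimes> k) (\<phi> (inv h) x))"
    by (rule sum.swap)
  also have "\<dots> = (\<Sum>l\<in>carrier G. a l x * (b \<otimes>\<^bsub>CP\<^esub> c) (inv l \<otimes> k) (\<phi> (inv l) x))"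
  proof (rule sum.cong [OF refl])
    fix l assume l: "l \<in> carrier G"
    have cancel: "inv l \<otimes> (l \<otimes> h) = h" if "h \<in> carrier G" for h
      using l that by (simp add: m_assoc [symmetric])
    have "(\<Sum>h\<in>carrier G. a l x * b (inv l \<otimes> h) (\<phi> (inv l) x) * c (inv h \<otimes> k) (\<phi> (inv h) x)) =
        (\<Sum>h\<in>carrier G. a l x * b (inv l \<otimes> (l \<otimes> h)) (\<phi> (inv l) x) *
          c (inv (l \<otimes> h) \<otimes> k) (\<phi> (inv (l \<otimes> h)) x))"
      by (rule sum_group_left [OF l, symmetric])
    also have "\<dots> = (\<Sum>h\<in>carrier G. a l x * (b h (\<phi> (inv l) x) *
          c (inv h \<otimes> (inv l \<otimes> k)) (\<phi> (inv h) (\<phi> (inv l) x))))"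
      using l k x by (intro sum.cong refl)
        (simp add: cancel m_assoc inv_mult_group composition_rule)
    also have "\<dots> = a l x * (b \<otimes>\<^bsub>CP\<^esub> c) (inv l \<otimes> k) (\<phi> (inv l) x)"
      using b c l k x by (simp add: crossed_product_mult_apply action_closed sum_distrib_left)
    finally show "(\<Sum>h\<in>carrier G. a l x * b (inv l \<otimes> h) (\<phi> (inv l) x) *
        c (inv h \<otimes> k) (\<phi> (inv h) x)) = a l x * (b \<otimes>\<^bsub>CP\<^esub> c) (inv l \<otimes> k) (\<phi> (inv l) x)" .
  qed
  also have "\<dots> = (a \<otimes>\<^bsub>CP\<^esub> (b \<otimes>\<^bsub>CP\<^esub> c)) k x"
    using a b c k x by (simp add: crossed_product_mult_apply crossed_product_mult_closed)
  finally show "((a \<otimes>\<^bsub>CP\<^esub> b) \<otimes>\<^bsub>CP\<^esub> c) k x = (a \<otimes>\<^bsub>CP\<^esub> (b \<otimes>\<^bsub>CP\<^esub> c)) k x" .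
qed

text \<open>The canonical embedding of C(X) into the crossed product: f goes to f times the
  implementing unitary of the identity.\<close>

definition coeff_embed :: "('a \<Rightarrow> complex) \<Rightarrow> 'g \<Rightarrow> 'a \<Rightarrow> complex" where
  "coeff_embed f = (\<lambda>k\<in>carrier G. if k = \<one> then f else (\<lambda>x. 0))"

lemma coeff_embed_closed: "f \<in> carrier C \<Longrightarrow> coeff_embed f \<in> carrier CP"
  by (auto simp: coeff_embed_def crossed_product_simps cont_algebra_zero_closed)

lemma crossed_product_one_eq: "\<one>\<^bsub>CP\<^esub> = coeff_embed \<one>\<^bsub>C\<^esub>"
  by (simp only: crossed_product_simps coeff_embed_def cont_algebra_simps)

lemma coeff_embed_mult_left:
  assumes "f \<in> carrier C" "a \<in> carrier CP" "k \<in> carrier G" "x \<in> topspace X"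
  shows "(coeff_embed f \<otimes>\<^bsub>CP\<^esub> a) k x = f x * a k x"
proof -
  have "(coeff_embed f \<otimes>\<^bsub>CP\<^esub> a) k x = (\<Sum>h\<in>carrier G. if h = \<one> then f x * a k x else 0)"
    unfolding crossed_product_mult_apply [OF coeff_embed_closed [OF assms(1)] assms(2-4)]
    using assms by (intro sum.cong) (auto simp: coeff_embed_def action_one)
  then show ?thesis
    using finite_group by simp
qed

text \<open>The translate in the argument of f is the covariance relation: moving f to the left past
  the unitary of k replaces it by \<open>\<alpha> k f\<close>.\<close>

lemma coeff_embed_mult_right:
  assumes "f \<in> carrier C" "a \<in> carrier CP" "k \<in> carrier G" "x \<in> topspace X"
  shows "(a \<otimes>\<^bsub>CP\<^esub> coeff_embed f) k x = a k x * f (\<phi> (inv k) x)"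
proof -
  have "inv h \<otimes> k = \<one> \<longleftrightarrow> h = k" if "h \<in> carrier G" for h
    using that assms(3) by (metis inv_closed inv_equality inv_inv l_inv)
  then have "(a \<otimes>\<^bsub>CP\<^esub> coeff_embed f) k x = (\<Sum>h\<in>carrier G. if h = k then a k x * f (\<phi> (inv k) x) else 0)"
    unfolding crossed_product_mult_apply [OF assms(2) coeff_embed_closed [OF assms(1)] assms(3,4)]
    using assms by (intro sum.cong) (auto simp: coeff_embed_def)
  then show ?thesis
    using finite_group assms by simp
qed

lemma crossed_product_ring: "ring CP"
proof (rule ringI)
  show "monoid CP"
  proof (rule monoidI)
    fix a assume a: "a \<in> carrier CP"
    show "\<one>\<^bsub>CP\<^esub> \<otimes>\<^bsub>CP\<^esub> a = a"
      using a unfolding crossed_product_one_eq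
      by (intro crossed_product_eqI crossed_product_mult_closed coeff_embed_closed)
        (simp_all add: coeff_embed_mult_left cont_algebra_one_closed)
    show "a \<otimes>\<^bsub>CP\<^esub> \<one>\<^bsub>CP\<^esub> = a"
      using a unfolding crossed_product_one_eq
      by (intro crossed_product_eqI crossed_product_mult_closed coeff_embed_closed)
        (simp_all add: coeff_embed_mult_right cont_algebra_one_closed action_closed)
  qed (auto simp: crossed_product_mult_closed crossed_product_one_closed crossed_product_mult_assoc)
  fix a b c assume *: "a \<in> carrier CP" "b \<in> carrier CP" "c \<in> carrier CP"
  then show "(a \<oplus>\<^bsub>CP\<^esub> b) \<otimes>\<^bsub>CP\<^esub> c = a \<otimes>\<^bsub>CP\<^esub> c \<oplus>\<^bsub>CP\<^esub> b \<otimes>\<^bsub>CP\<^esub> c"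
    by (intro crossed_product_eqI crossed_product_mult_closed crossed_product_add_closed)
      (simp_all add: crossed_product_mult_apply crossed_product_add_closed
        crossed_product_add_apply distrib_right sum.distrib)
  show "c \<otimes>\<^bsub>CP\<^esub> (a \<oplus>\<^bsub>CP\<^esub> b) = c \<otimes>\<^bsub>CP\<^esub> a \<oplus>\<^bsub>CP\<^esub> c \<otimes>\<^bsub>CP\<^esub> b"
    using * by (intro crossed_product_eqI crossed_product_mult_closed crossed_product_add_closed)
      (simp_all add: crossed_product_mult_apply crossed_product_add_closed
        crossed_product_add_apply distrib_left sum.distrib)
qed (rule crossed_product_abelian_group)

lemma crossed_product_uminus:
  assumes "a \<in> carrier CP"
  shows "\<ominus>\<^bsub>CP\<^esub> a = (\<lambda>k\<in>carrier G. \<lambda>x. - a k x)"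
proof -
  interpret abelian_group CP
    by (rule crossed_product_abelian_group)
  show ?thesis
    using assms by (intro minus_equality crossed_product_uminus_closed)
      (auto simp: crossed_product_simps intro: restrict_ext)
qed

lemma crossed_product_minus_apply:
  assumes "b \<in> carrier CP" "k \<in> carrier G"
  shows "(a \<ominus>\<^bsub>CP\<^esub> b) k x = a k x - b k x"
  using assms by (simp add: a_minus_def crossed_product_uminus crossed_product_add_apply)

lemma crossed_product_finsum_apply:
  assumes "finite A" "\<And>i. i \<in> A \<Longrightarrow> a i \<in> carrier CP" "k \<in> carrier G"
  shows "(\<Oplus>\<^bsub>CP\<^esub>i\<in>A. a i) k x = (\<Sum>i\<in>A. a i k x)"
proof -
  interpret abelian_group CP
    by (rule crossed_product_abelian_group)
  show ?thesis
    using assms(1,2)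
  proof (induction A rule: finite_induct)
    case empty
    show ?case
      using assms(3) by (simp add: crossed_product_simps)
  next
    case (insert i A)
    then have "finsum CP a (insert i A) = a i \<oplus>\<^bsub>CP\<^esub> finsum CP a A"
      by (intro finsum_insert) auto
    with insert show ?case
      using assms(3) by (simp add: crossed_product_add_apply)
  qed
qed

section \<open>The averaging projection and saturation of free actions\<close>

abbreviation "e \<equiv> averaging_projection C G \<alpha>"

lemma implementing_unitary_closed: "g \<in> carrier G \<Longrightarrow> implementing_unitary C G g \<in> carrier CP"
  by (auto simp: implementing_unitary_def crossed_product_simps cont_algebra_zero_closed
      cont_algebra_one_closed)

lemma averaging_projection_closed: "e \<in> carrier CP"
proof -
  interpret abelian_group CP
    by (rule crossed_product_abelian_group)
  have "(\<Oplus>\<^bsub>CP\<^esub>g\<in>carrier G. implementing_unitary C G g) \<in> carrier CP"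
    by (intro finsum_closed) (auto intro: implementing_unitary_closed)
  then show ?thesis
    unfolding averaging_projection_def crossed_product_simps(1,6) cont_algebra_simps
    by (intro restrict_PiE_iff [THEN iffD2] ballI cont_algebra_scale_closed) auto
qed

lemma averaging_projection_apply:
  assumes "k \<in> carrier G" "x \<in> topspace X"
  shows "e k x = 1 / of_nat (order G)"
proof -
  have "(\<Oplus>\<^bsub>CP\<^esub>g\<in>carrier G. implementing_unitary C G g) k x =
      (\<Sum>g\<in>carrier G. implementing_unitary C G g k x)"
    using assms finite_group
    by (intro crossed_product_finsum_apply) (auto intro: implementing_unitary_closed)
  also have "\<dots> = (\<Sum>g\<in>carrier G. if g = k then 1 else 0)"
    using assms by (intro sum.cong) (auto simp: implementing_unitary_def)
  also have "\<dots> = 1"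
    using assms finite_group by simp
  finally show ?thesis
    using assms by (simp add: averaging_projection_def crossed_product_simps(6))
qed

text \<open>All coefficients of \<open>e\<close> are the constant 1/|G| on X. Hence the coefficient
  of the sum at k is 1/|G| times the frame kernel at \<open>inv k\<close>, which is 1 for
  \<open>k = \<one>\<close> and 0 otherwise.\<close>

lemma orbit_frame_decomposition_of_one:
  assumes frame: "orbit_frame n v"
  shows "(\<Oplus>\<^bsub>CP\<^esub>i\<in>{..<n}. coeff_embed (v i) \<otimes>\<^bsub>CP\<^esub> e \<otimes>\<^bsub>CP\<^esub> coeff_embed (\<lambda>x. cnj (v i x))) = \<one>\<^bsub>CP\<^esub>"
proof (rule crossed_product_eqI)
  interpret ring CP
    by (rule crossed_product_ring)
  note v = orbit_frame_closed [OF frame]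
  note closed = coeff_embed_closed [OF v] coeff_embed_closed [OF cont_algebra_cnj_closed [OF v]]
    averaging_projection_closed
  have summand: "coeff_embed (v i) \<otimes>\<^bsub>CP\<^esub> e \<otimes>\<^bsub>CP\<^esub> coeff_embed (\<lambda>x. cnj (v i x)) \<in> carrier CP" if "i < n" for i
    using closed that by simp
  then show "(\<Oplus>\<^bsub>CP\<^esub>i\<in>{..<n}. coeff_embed (v i) \<otimes>\<^bsub>CP\<^esub> e \<otimes>\<^bsub>CP\<^esub> coeff_embed (\<lambda>x. cnj (v i x))) \<in> carrier CP"
    by (intro finsum_closed) auto
  fix k x assume k: "k \<in> carrier G" and x: "x \<in> topspace X"
  have "(\<Oplus>\<^bsub>CP\<^esub>i\<in>{..<n}. coeff_embed (v i) \<otimes>\<^bsub>CP\<^esub> e \<otimes>\<^bsub>CP\<^esub> coeff_embed (\<lambda>x. cnj (v i x))) k x =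
      (\<Sum>i<n. (coeff_embed (v i) \<otimes>\<^bsub>CP\<^esub> e \<otimes>\<^bsub>CP\<^esub> coeff_embed (\<lambda>x. cnj (v i x))) k x)"
    using summand k by (intro crossed_product_finsum_apply) auto
  also have "\<dots> = (\<Sum>i<n. 1 / of_nat (order G) * (v i x * cnj (v i (\<phi> (inv k) x))))"
    using closed v k x
    by (intro sum.cong refl) (simp add: coeff_embed_mult_right coeff_embed_mult_left cont_algebra_cnj_closed
        averaging_projection_apply)
  also have "\<dots> = 1 / of_nat (order G) * (\<Sum>i<n. v i x * cnj (v i (\<phi> (inv k) x)))"
    by (simp only: sum_distrib_left)
  also have "\<dots> = \<one>\<^bsub>CP\<^esub> k x"
    using orbit_frame_sum [OF frame x, of "inv k"] k x order_nonzero
    by (auto simp: crossed_product_simps inv_eq_1_iff)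
  finally show "(\<Oplus>\<^bsub>CP\<^esub>i\<in>{..<n}. coeff_embed (v i) \<otimes>\<^bsub>CP\<^esub> e \<otimes>\<^bsub>CP\<^esub> coeff_embed (\<lambda>x. cnj (v i x))) k x = \<one>\<^bsub>CP\<^esub> k x" .
qed (rule crossed_product_one_closed)

lemma free_action_imp_saturated:
  assumes "free_action X G \<phi>"
  shows "saturated C G \<alpha>"
proof -
  obtain n v where frame: "orbit_frame n v"
    by (rule free_action_orbit_frame [OF assms])
  \<comment> \<open>The decomposition puts the unit into every ideal containing \<open>e\<close>.
    The intersection defining the generated closed ideal therefore runs over the whole algebra
    alone.\<close>
  have "I = carrier CP" if I: "ideal I CP" "e \<in> I" for I
  proof -
    interpret ideal I CP by fact
    have "(\<Oplus>\<^bsub>CP\<^esub>i\<in>{..<n}. coeff_embed (v i) \<otimes>\<^bsub>CP\<^esub> e \<otimes>\<^bsub>CP\<^esub> coeff_embed (\<lambda>x. cnj (v i x))) \<in> I"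
      using I(2) orbit_frame_closed [OF frame]
      by (intro finsum_in_ideal I_r_closed I_l_closed)
        (auto intro: coeff_embed_closed cont_algebra_cnj_closed)
    then show ?thesis
      unfolding orbit_frame_decomposition_of_one [OF frame] by (rule one_imp_carrier)
  qed
  moreover have "ideal (carrier CP) CP" "norm_closed CP (carrier CP)"
    using ring.oneideal [OF crossed_product_ring] by (auto simp: norm_closed_def)
  ultimately have "{I. ideal I CP \<and> norm_closed CP I \<and> {e} \<subseteq> I} = {carrier CP}"
    using averaging_projection_closed by blast
  then show ?thesis
    by (simp add: saturated_def closed_genideal_def)
qed

subsection \<open>The norm\<close>

lemma l2_norm_eq:
  assumes "\<xi> \<in> carrier CP"
  shows "l2_norm C G \<xi> = sqrt \<parallel>\<lambda>x. \<Sum>h\<in>carrier G. of_real ((cmod (\<xi> h x))\<^sup>2)\<parallel>\<^bsub>C\<^esub>"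
proof -
  have "(\<Oplus>\<^bsub>C\<^esub>h\<in>carrier G. (\<sharp>\<^bsub>C\<^esub> (\<xi> h)) \<otimes>\<^bsub>C\<^esub> \<xi> h) =
      (\<lambda>x. \<Sum>h\<in>carrier G. cnj (\<xi> h x) * \<xi> h x)"
    unfolding cont_algebra_simps using assms
    by (intro cont_algebra_finsum finite_group cont_algebra_mult_closed cont_algebra_cnj_closed)
      (auto intro: crossed_product_coeff)
  also have "\<dots> = (\<lambda>x. \<Sum>h\<in>carrier G. of_real ((cmod (\<xi> h x))\<^sup>2))"
    by (simp only: complex_norm_square mult.commute)
  finally show ?thesis
    by (simp only: l2_norm_def)
qed

text \<open>One squared coefficient is at most the sum of all of them, and this sum at x is at most
  its supremum.\<close>

lemma coeff_le_l2_norm: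
  assumes \<xi>: "\<xi> \<in> carrier CP" and h: "h \<in> carrier G"
  shows "cmod (\<xi> h x) \<le> l2_norm C G \<xi>"
proof -
  let ?p = "\<lambda>x. \<Sum>h\<in>carrier G. complex_of_real ((cmod (\<xi> h x))\<^sup>2)"
  have "?p = (\<lambda>x. \<Sum>h\<in>carrier G. cnj (\<xi> h x) * \<xi> h x)"
    by (simp only: complex_norm_square mult.commute)
  also have "\<dots> \<in> carrier C"
    using \<xi> by (intro cont_algebra_sum_closed finite_group cont_algebra_mult_closed
        cont_algebra_cnj_closed) (auto intro: crossed_product_coeff)
  finally have p: "?p \<in> carrier C" .
  have "(cmod (\<xi> h x))\<^sup>2 \<le> (\<Sum>h\<in>carrier G. (cmod (\<xi> h x))\<^sup>2)"
    using h finite_group by (intro member_le_sum) auto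
  also have "\<dots> \<le> cmod (?p x)"
    unfolding of_real_sum [symmetric] norm_of_real by simp
  also have "\<dots> \<le> \<parallel>?p\<parallel>\<^bsub>C\<^esub>"
    by (rule cont_algebra_norm_upper [OF compact p])
  finally show ?thesis
    unfolding l2_norm_eq [OF \<xi>] by (rule real_le_rsqrt)
qed

lemma l2_norm_le:
  assumes \<xi>: "\<xi> \<in> carrier CP" and le: "\<And>x. (\<Sum>h\<in>carrier G. (cmod (\<xi> h x))\<^sup>2) \<le> B"
  shows "l2_norm C G \<xi> \<le> sqrt B"
proof -
  have "cmod (\<Sum>h\<in>carrier G. complex_of_real ((cmod (\<xi> h x))\<^sup>2)) \<le> B" for x
    using le [of x] unfolding of_real_sum [symmetric] norm_of_real by (simp add: sum_nonneg)
  then show ?thesis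
    unfolding l2_norm_eq [OF \<xi>] by (intro real_sqrt_le_mono cont_algebra_norm_least)
qed

lemma regular_rep_eq:
  assumes "a \<in> carrier CP" "\<xi> \<in> carrier CP"
  shows "regular_rep C G \<alpha> a \<xi> =
    (\<lambda>h\<in>carrier G. \<lambda>x. \<Sum>g\<in>carrier G. \<alpha> (inv h) (a g) x * \<xi> (inv g \<otimes> h) x)"
  unfolding regular_rep_def cont_algebra_simps using assms
  by (intro restrict_ext cont_algebra_finsum finite_group cont_algebra_mult_closed
      induced_action_closed) (auto intro: crossed_product_coeff)

lemma regular_rep_closed:
  assumes "a \<in> carrier CP" "\<xi> \<in> carrier CP"
  shows "regular_rep C G \<alpha> a \<xi> \<in> carrier CP"
  unfolding regular_rep_eq [OF assms] crossed_product_simps(1) using assms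
  by (intro restrict_PiE_iff [THEN iffD2] ballI cont_algebra_sum_closed finite_group
      cont_algebra_mult_closed induced_action_closed) (auto intro: crossed_product_coeff)

text \<open>Makes the supremum in the operator norm a genuine one. A crude bound does: coefficients
  of the unit ball are at most 1, so those of the image are at most the sum \<open>?K\<close> of the
  norms of the \<open>a g\<close>.\<close>

lemma regular_rep_bounded:
  assumes a: "a \<in> carrier CP"
  shows "bdd_above {l2_norm C G (regular_rep C G \<alpha> a \<xi>) | \<xi>.
    \<xi> \<in> carrier CP \<and> l2_norm C G \<xi> \<le> 1}"
proof (rule bdd_aboveI)
  let ?K = "\<Sum>g\<in>carrier G. \<parallel>a g\<parallel>\<^bsub>C\<^esub>"
  fix r assume "r \<in> {l2_norm C G (regular_rep C G \<alpha> a \<xi>) | \<xi>.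
    \<xi> \<in> carrier CP \<and> l2_norm C G \<xi> \<le> 1}"
  then obtain \<xi> where \<xi>: "\<xi> \<in> carrier CP" "l2_norm C G \<xi> \<le> 1"
    and r: "r = l2_norm C G (regular_rep C G \<alpha> a \<xi>)"
    by blast
  have "cmod (regular_rep C G \<alpha> a \<xi> h x) \<le> ?K" if h: "h \<in> carrier G" for h x
  proof -
    have "regular_rep C G \<alpha> a \<xi> h x = (\<Sum>g\<in>carrier G. \<alpha> (inv h) (a g) x * \<xi> (inv g \<otimes> h) x)"
      using h by (simp add: regular_rep_eq [OF a \<xi>(1)])
    also have "cmod \<dots> \<le> ?K"
    proof (rule sum_norm_le)
      fix g assume g: "g \<in> carrier G"
      have bound: "cmod (a g y) \<le> \<parallel>a g\<parallel>\<^bsub>C\<^esub>" for y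
        by (rule cont_algebra_norm_upper [OF compact crossed_product_coeff [OF a g]])
      then have "0 \<le> \<parallel>a g\<parallel>\<^bsub>C\<^esub>"
        by (rule order_trans [OF norm_ge_zero])
      with bound have "cmod (\<alpha> (inv h) (a g) x) \<le> \<parallel>a g\<parallel>\<^bsub>C\<^esub>"
        by (simp add: induced_action_def)
      moreover have "cmod (\<xi> (inv g \<otimes> h) x) \<le> 1"
        using coeff_le_l2_norm [OF \<xi>(1), of "inv g \<otimes> h" x] \<xi>(2) g h by simp
      ultimately show "cmod (\<alpha> (inv h) (a g) x * \<xi> (inv g \<otimes> h) x) \<le> \<parallel>a g\<parallel>\<^bsub>C\<^esub>"
        unfolding norm_mult
        using mult_mono [of "cmod (\<alpha> (inv h) (a g) x)" "\<parallel>a g\<parallel>\<^bsub>C\<^esub>" "cmod (\<xi> (inv g \<otimes> h) x)" 1]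
          \<open>0 \<le> \<parallel>a g\<parallel>\<^bsub>C\<^esub>\<close> by simp
    qed
    finally show ?thesis .
  qed
  then have "(\<Sum>h\<in>carrier G. (cmod (regular_rep C G \<alpha> a \<xi> h x))\<^sup>2) \<le> (\<Sum>h\<in>carrier G. ?K\<^sup>2)" for x
    by (intro sum_mono power_mono) auto
  then show "r \<le> sqrt (\<Sum>h\<in>carrier G. ?K\<^sup>2)"
    unfolding r by (intro l2_norm_le regular_rep_closed a \<xi>(1))
qed

text \<open>Apply the regular representation of \<open>a\<close> to the unit vector at \<open>\<one>\<close>.\<close>

lemma coeff_le_crossed_product_norm:
  assumes a: "a \<in> carrier CP" and g: "g \<in> carrier G" and y: "y \<in> topspace X"
  shows "cmod (a g y) \<le> \<parallel>a\<parallel>\<^bsub>CP\<^esub>"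
proof -
  \<comment> \<open>At this vector the image has the g-coefficient
    \<open>\<alpha> (inv g) (a g)\<close>, whose value at z is \<open>a g (\<phi> g z)\<close>; the
    choice of \<open>?x\<close> turns this into \<open>a g y\<close>.\<close>
  let ?\<xi> = "coeff_embed \<one>\<^bsub>C\<^esub>" and ?x = "\<phi> (inv g) y"
  have \<xi>: "?\<xi> \<in> carrier CP"
    by (rule coeff_embed_closed) (simp add: cont_algebra_one_closed)
  have x: "?x \<in> topspace X" "\<phi> g ?x = y"
    using g y orbit_sym_aux [of "inv g" y] by (auto simp: action_closed)
  have "(\<Sum>h\<in>carrier G. (cmod (?\<xi> h x))\<^sup>2) \<le> (\<Sum>h\<in>carrier G. if h = \<one> then 1 else 0)" for x
    by (intro sum_mono) (auto simp: coeff_embed_def)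
  then have "l2_norm C G ?\<xi> \<le> sqrt (\<Sum>h\<in>carrier G. if h = \<one> then 1 else 0)"
    by (rule l2_norm_le [OF \<xi>])
  then have \<xi>1: "l2_norm C G ?\<xi> \<le> 1"
    using finite_group by simp
  have inv_eq: "inv h \<otimes> g = \<one> \<longleftrightarrow> h = g" if "h \<in> carrier G" for h
    using that g by (metis inv_closed inv_equality inv_inv l_inv)
  have "regular_rep C G \<alpha> a ?\<xi> g ?x = (\<Sum>h\<in>carrier G. \<alpha> (inv g) (a h) ?x * ?\<xi> (inv h \<otimes> g) ?x)"
    unfolding regular_rep_eq [OF a \<xi>] using g by simp
  also have "\<dots> = (\<Sum>h\<in>carrier G. if h = g then a g y else 0)"
    using g x inv_eq by (intro sum.cong) (auto simp: coeff_embed_def induced_action_apply)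
  also have "\<dots> = a g y"
    using g finite_group by simp
  finally have "cmod (a g y) = cmod (regular_rep C G \<alpha> a ?\<xi> g ?x)"
    by (rule arg_cong [OF sym])
  also have "\<dots> \<le> l2_norm C G (regular_rep C G \<alpha> a ?\<xi>)"
    by (rule coeff_le_l2_norm [OF regular_rep_closed [OF a \<xi>] g])
  also have "\<dots> \<le> \<parallel>a\<parallel>\<^bsub>CP\<^esub>"
    unfolding crossed_product_norm using \<xi> \<xi>1
    by (intro cSup_upper regular_rep_bounded [OF a]) blast
  finally show ?thesis .
qed

subsection \<open>The ideal of stabilizer-invariant elements\<close>

text \<open>The condition says that \<open>a g y\<close> depends on g only through the point
  \<open>\<phi> (inv g) y\<close>. Such elements are kernels on the orbit equivalence relation, and
  multiplication in the crossed product respects this.\<close>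

definition stabilizer_ideal :: "('g \<Rightarrow> 'a \<Rightarrow> complex) set" where
  "stabilizer_ideal = {a \<in> carrier CP.
    \<forall>y\<in>topspace X. \<forall>t\<in>stabilizer G \<phi> y. \<forall>g\<in>carrier G. a (t \<otimes> g) y = a g y}"

lemma stabilizer_idealD:
  assumes "a \<in> stabilizer_ideal" "y \<in> topspace X" "t \<in> carrier G" "\<phi> t y = y" "g \<in> carrier G"
  shows "a (t \<otimes> g) y = a g y"
  using assms by (auto simp: stabilizer_ideal_def stabilizer_def)

lemma stabilizer_idealI:
  assumes "a \<in> carrier CP"
    "\<And>y t g. y \<in> topspace X \<Longrightarrow> t \<in> carrier G \<Longrightarrow> \<phi> t y = y \<Longrightarrow> g \<in> carrier G \<Longrightarrow> a (t \<otimes> g) y = a g y"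
  shows "a \<in> stabilizer_ideal"
  using assms by (auto simp: stabilizer_ideal_def stabilizer_def)

lemma stabilizer_ideal_carrier: "a \<in> stabilizer_ideal \<Longrightarrow> a \<in> carrier CP"
  by (simp add: stabilizer_ideal_def)

text \<open>If t fixes y, then the conjugate \<open>inv h \<otimes> t \<otimes> h\<close> fixes
  \<open>\<phi> (inv h) y\<close>. So invariance of b at that point lets t be dropped in each
  summand of the convolution.\<close>

lemma stabilizer_ideal_mult_left:
  assumes a: "a \<in> carrier CP" and b: "b \<in> stabilizer_ideal"
  shows "a \<otimes>\<^bsub>CP\<^esub> b \<in> stabilizer_ideal"
proof (rule stabilizer_idealI)
  note bC = stabilizer_ideal_carrier [OF b]
  show "a \<otimes>\<^bsub>CP\<^esub> b \<in> carrier CP"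
    by (rule crossed_product_mult_closed [OF a bC])
  fix y t g assume y: "y \<in> topspace X" and t: "t \<in> carrier G" "\<phi> t y = y" and g: "g \<in> carrier G"
  have "b (inv h \<otimes> (t \<otimes> g)) (\<phi> (inv h) y) = b (inv h \<otimes> g) (\<phi> (inv h) y)" if h: "h \<in> carrier G" for h
  proof -
    have "h \<otimes> (inv h \<otimes> g) = g"
      using h g by (simp add: m_assoc [symmetric])
    then have "inv h \<otimes> (t \<otimes> g) = (inv h \<otimes> t \<otimes> h) \<otimes> (inv h \<otimes> g)"
      using h t g by (simp add: m_assoc)
    moreover have "\<phi> (inv h \<otimes> t \<otimes> h) (\<phi> (inv h) y) = \<phi> (inv h) y"
      \<comment> \<open>The two actions are merged into that of \<open>inv h \<otimes> t\<close>,
        which is then split again so that \<open>\<phi> t y = y\<close> applies.\<close>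
      using h t y by (simp add: composition_rule [symmetric] action_closed m_assoc)
        (simp add: composition_rule)
    ultimately show ?thesis
      using h t g y by (simp add: stabilizer_idealD [OF b] action_closed)
  qed
  then show "(a \<otimes>\<^bsub>CP\<^esub> b) (t \<otimes> g) y = (a \<otimes>\<^bsub>CP\<^esub> b) g y"
    using y t g by (simp add: crossed_product_mult_apply [OF a bC])
qed

text \<open>Here the summation index is shifted from h to \<open>t \<otimes> h\<close>: invariance
  of a removes t from its coefficient, and in the factor b the two occurrences of t cancel and
  \<open>inv t\<close> fixes y.\<close>

lemma stabilizer_ideal_mult_right:
  assumes a: "a \<in> stabilizer_ideal" and b: "b \<in> carrier CP"
  shows "a \<otimes>\<^bsub>CP\<^esub> b \<in> stabilizer_ideal"
proof (rule stabilizer_idealI)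
  note aC = stabilizer_ideal_carrier [OF a]
  show "a \<otimes>\<^bsub>CP\<^esub> b \<in> carrier CP"
    by (rule crossed_product_mult_closed [OF aC b])
  fix y t g assume y: "y \<in> topspace X" and t: "t \<in> carrier G" "\<phi> t y = y" and g: "g \<in> carrier G"
  have "\<phi> (inv t) y = y"
    using t y orbit_sym_aux by blast
  have "(a \<otimes>\<^bsub>CP\<^esub> b) (t \<otimes> g) y =
      (\<Sum>h\<in>carrier G. a h y * b (inv h \<otimes> (t \<otimes> g)) (\<phi> (inv h) y))"
    using y t g by (simp add: crossed_product_mult_apply [OF aC b])
  also have "\<dots> = (\<Sum>h\<in>carrier G. a (t \<otimes> h) y * b (inv (t \<otimes> h) \<otimes> (t \<otimes> g)) (\<phi> (inv (t \<otimes> h)) y))"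
    by (rule sum_group_left [OF t(1), symmetric])
  also have "\<dots> = (\<Sum>h\<in>carrier G. a h y * b (inv h \<otimes> g) (\<phi> (inv h) y))"
  proof (rule sum.cong [OF refl])
    fix h assume h: "h \<in> carrier G"
    have "inv t \<otimes> (t \<otimes> g) = g"
      using t g by (simp add: m_assoc [symmetric])
    then have "inv (t \<otimes> h) \<otimes> (t \<otimes> g) = inv h \<otimes> g"
      using t g h by (simp add: inv_mult_group m_assoc)
    moreover have "\<phi> (inv (t \<otimes> h)) y = \<phi> (inv h) y"
      using t h y \<open>\<phi> (inv t) y = y\<close> by (simp add: inv_mult_group composition_rule)
    ultimately show "a (t \<otimes> h) y * b (inv (t \<otimes> h) \<otimes> (t \<otimes> g)) (\<phi> (inv (t \<otimes> h)) y) =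
        a h y * b (inv h \<otimes> g) (\<phi> (inv h) y)"
      by (simp add: stabilizer_idealD [OF a y t h])
  qed
  also have "\<dots> = (a \<otimes>\<^bsub>CP\<^esub> b) g y"
    using y g by (simp add: crossed_product_mult_apply [OF aC b])
  finally show "(a \<otimes>\<^bsub>CP\<^esub> b) (t \<otimes> g) y = (a \<otimes>\<^bsub>CP\<^esub> b) g y" .
qed

lemma ideal_stabilizer_ideal: "ideal stabilizer_ideal CP"
proof (rule idealI)
  interpret ring CP
    by (rule crossed_product_ring)
  show "subgroup stabilizer_ideal (add_monoid CP)"
  proof (rule add.subgroupI)
    show "stabilizer_ideal \<subseteq> carrier CP"
      using stabilizer_ideal_carrier by blast
    have "\<zero>\<^bsub>CP\<^esub> \<in> stabilizer_ideal"
      by (rule stabilizer_idealI [OF crossed_product_zero_closed]) (simp add: crossed_product_simps(4))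
    then show "stabilizer_ideal \<noteq> {}"
      by blast
    show "\<ominus>\<^bsub>CP\<^esub> a \<in> stabilizer_ideal" if a: "a \<in> stabilizer_ideal" for a
      unfolding crossed_product_uminus [OF stabilizer_ideal_carrier [OF a]]
      by (rule stabilizer_idealI [OF crossed_product_uminus_closed [OF stabilizer_ideal_carrier [OF a]]])
        (simp add: stabilizer_idealD [OF a])
    show "a \<oplus>\<^bsub>CP\<^esub> b \<in> stabilizer_ideal" if a: "a \<in> stabilizer_ideal" and b: "b \<in> stabilizer_ideal" for a b
      using stabilizer_ideal_carrier [OF a] stabilizer_ideal_carrier [OF b]
      by (intro stabilizer_idealI)
        (simp_all add: crossed_product_add_apply stabilizer_idealD [OF a] stabilizer_idealD [OF b])
  qed
qed (simp_all only: crossed_product_ring stabilizer_ideal_mult_left stabilizer_ideal_mult_right)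

text \<open>Membership equates point values of coefficients, and these are dominated by the norm of
  the crossed product, so the equations pass to limits.\<close>

lemma norm_closed_stabilizer_ideal: "norm_closed CP stabilizer_ideal"
  unfolding norm_closed_def
proof (intro ballI impI)
  fix a assume a: "a \<in> carrier CP"
    and lim: "\<forall>\<epsilon>>0. \<exists>s\<in>stabilizer_ideal. \<parallel>a \<ominus>\<^bsub>CP\<^esub> s\<parallel>\<^bsub>CP\<^esub> < \<epsilon>"
  show "a \<in> stabilizer_ideal"
  proof (rule stabilizer_idealI [OF a])
    fix y t g assume y: "y \<in> topspace X" and t: "t \<in> carrier G" "\<phi> t y = y" and g: "g \<in> carrier G"
    have "dist (a (t \<otimes> g) y) (a g y) \<le> 0 + \<epsilon>" if "\<epsilon> > 0" for \<epsilon>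
    proof -
      obtain s where s: "s \<in> stabilizer_ideal" "\<parallel>a \<ominus>\<^bsub>CP\<^esub> s\<parallel>\<^bsub>CP\<^esub> < \<epsilon> / 2"
        using lim half_gt_zero [OF \<open>\<epsilon> > 0\<close>] by blast
      note sC = stabilizer_ideal_carrier [OF s(1)]
      have "a \<ominus>\<^bsub>CP\<^esub> s \<in> carrier CP"
        by (rule abelian_group.minus_closed [OF crossed_product_abelian_group a sC])
      then have close: "cmod (a h y - s h y) < \<epsilon> / 2" if "h \<in> carrier G" for h
        using coeff_le_crossed_product_norm [OF _ that y] s(2)
          crossed_product_minus_apply [OF sC that, of a y] by fastforce
      have "dist (a (t \<otimes> g) y) (a g y) \<le> cmod (a (t \<otimes> g) y - s (t \<otimes> g) y) + cmod (a g y - s g y)"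
        unfolding dist_norm stabilizer_idealD [OF s(1) y t g]
        using norm_triangle_ineq4 [of "a (t \<otimes> g) y - s g y" "a g y - s g y"] by simp
      also have "\<dots> \<le> 0 + \<epsilon>"
        using close [of "t \<otimes> g"] close [of g] t g by simp
      finally show ?thesis .
    qed
    then show "a (t \<otimes> g) y = a g y"
      using field_le_epsilon [of "dist (a (t \<otimes> g) y) (a g y)" 0] by simp
  qed
qed

lemma averaging_projection_in_stabilizer_ideal: "e \<in> stabilizer_ideal"
  by (rule stabilizer_idealI) (simp_all add: averaging_projection_closed averaging_projection_apply)

lemma saturated_imp_free_action:
  assumes "saturated C G \<alpha>"
  shows "free_action X G \<phi>"
proof -
  have "closed_genideal CP {e} \<subseteq> stabilizer_ideal"
    unfolding closed_genideal_def
    using ideal_stabilizer_ideal norm_closed_stabilizer_ideal averaging_projection_in_stabilizer_ideal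
    by blast
  then have one: "\<one>\<^bsub>CP\<^esub> \<in> stabilizer_ideal"
    using assms crossed_product_one_closed by (auto simp: saturated_def)
  show ?thesis
    unfolding free_action_def
  proof (intro ballI impI notI)
    fix x g assume "x \<in> topspace X" "g \<in> carrier G" "g \<noteq> \<one>" "\<phi> g x = x"
    \<comment> \<open>With \<open>t = g\<close> invariance equates the coefficients of the unit at g
      and at \<open>\<one>\<close>, whose values at x are 0 and 1.\<close>
    then show False
      using stabilizer_idealD [OF one, of x g \<one>] by (simp add: crossed_product_simps)
  qed
qed

end

theorem corollary4p11:
  fixes X :: "'a topology"
    and G :: "('g, 'n) monoid_scheme"
    and \<phi> :: "'g \<Rightarrow> 'a \<Rightarrow> 'a"
    and \<alpha> :: "'g \<Rightarrow> ('a \<Rightarrow> complex) \<Rightarrow> 'a \<Rightarrow> complex"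
    and E :: "('a \<Rightarrow> complex) \<Rightarrow> 'a \<Rightarrow> complex"
  assumes "compact_space X" and "Hausdorff_space X"
    and "group G" and "finite (carrier G)"
    and "group_action G (topspace X) \<phi>"
    and "\<And>g. g \<in> carrier G \<Longrightarrow> homeomorphic_map X X (\<phi> g)"
    and "\<alpha> = induced_action X G \<phi>"
    and "E = canonical_expectation (cont_algebra X) G \<alpha>"
  shows "(free_action X G \<phi> \<longleftrightarrow>
            index_finite_type (cont_algebra X) (fixed_point_algebra (cont_algebra X) G \<alpha>) E \<and>
            expectation_index (cont_algebra X) E
              = of_nat (order G) \<odot>\<^bsub>cont_algebra X\<^esub> \<one>\<^bsub>cont_algebra X\<^esub>) \<and>
         (free_action X G \<phi> \<longleftrightarrow> saturated (cont_algebra X) G \<alpha>)"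
proof -
  interpret compact_group_action X G \<phi>
    using assms(1-6)
    by (intro compact_group_action.intro compact_group_action_axioms.intro)
      (auto intro: homeomorphic_imp_continuous_map)
  show ?thesis
    unfolding assms(7,8)
    using free_action_imp_index_finite index_finite_imp_free_action
      free_action_imp_saturated saturated_imp_free_action by blast
qed

end
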